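(* Let $\boldsymbol{\sigma}=(\sigma_n)_{n\ge0}$, $\sigma_n:\mathcal{A}_{n+1}\to\mathcal{A}_n^+$, be an everywhere growing sequence of morphisms and let $(X_B,\varphi_\omega)$ be the natural Bratteli-Vershik dynamical system associated with $\boldsymbol{\sigma}$. Then $(X_{\boldsymbol{\sigma}},T)$ is an almost-factor of $(X_B,\varphi_\omega)$. If moreover $\boldsymbol{\sigma}$ is recognizable, then $(X_{\boldsymbol{\sigma}},T)$ is almost-conjugate to $(X_B,\varphi_\omega)$.
   Context: $S$-adic shifts. Alphabets are finite. A morphism $\sigma:\mathcal{A}\to\mathcal{B}^+$ is given by a non-empty word $\sigma(a)$ for each letter $a$ and is extended by concatenation to $\mathcal{A}^*$ and $\mathcal{A}^{\mathbb{Z}}$ (with $\sigma(x_0)$ starting at index $0$ in $\sigma(x)$). $T$ is the left shift. For $0\le n<N$, $\sigma_{[n,N)}=\sigma_n\circ\cdots\circ\sigma_{N-1}$. $\boldsymbol{\sigma}$ is everywhere growing if $\lim_{n\to\infty}\min_{a\in\mathcal{A}_n}|\sigma_{[0,n)}(a)|=\infty$. $\mathcal{L}_{\boldsymbol{\sigma}}^{(n)}$ is the set of $w\in\mathcal{A}_n^*$ that are subwords (factors) of $\sigma_{[n,N)}(a)$ for some $N>n$, $a\in\mathcal{A}_N$; $X_{\boldsymbol{\sigma}}^{(n)}$ is the set of $x\in\mathcal{A}_n^{\mathbb{Z}}$ all of whose finite subwords are in $\mathcal{L}_{\boldsymbol{\sigma}}^{(n)}$, and $X_{\boldsymbol{\sigma}}=X_{\boldsymbol{\sigma}}^{(0)}$.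 Recognizability. A $\sigma$-representation of $y$ is a pair $(k,x)$, $k\in\mathbb{Z}$, with $y=T^k\sigma(x)$; it is centered if $0\le k<|\sigma(x_0)|$ and is in $X$ if $x\in X$. $\boldsymbol{\sigma}$ is recognizable if for every $n\ge0$ each $y\in\mathcal{A}_n^{\mathbb{Z}}$ has at most one centered $\sigma_n$-representation in $X_{\boldsymbol{\sigma}}^{(n+1)}$. Natural Bratteli-Vershik system. The natural ordered Bratteli diagram $(B,\omega)$ of $\boldsymbol{\sigma}$ has vertex sets $V_0=\{v_0\}$ and, for $n\ge1$, $V_n$ a copy of $\mathcal{A}_{n-1}$. The edge set $E_0$ has exactly one edge from $v_0$ to each vertex of $V_1$. For $n\ge1$, $E_n$ is the set of edges from $V_n$ to $V_{n+1}$ such that for each $a\in\mathcal{A}_n$ (vertex of $V_{n+1}$) and each $1\le j\le|\sigma_{n-1}(a)|$ there is exactly one edge with range $a$ labelled $j-1$, and its source is the $j$-th letter of $\sigma_{n-1}(a)$ (a vertex of $V_n$). The edges with common range are linearly ordered by their labels. $X_B$ is the space of infinite paths $(x_0,x_1,\dots)$, $x_n\in E_n$, starting at $v_0$ (the range of $x_n$ is the source of $x_{n+1}$), with the topology generated by cylinder sets. A (finite or infinite) path is maximal (minimal) if each of its edges is maximal (minimal) among the edges with the same range; $X_{\max}(\omega)$, $X_{\min}(\omega)$ are the sets of infinite maximal, minimal paths in $X_B$. For $x\in X_B\setminus X_{\max}(\omega)$, let $n$ be smallest such that $x_n$ is not a maximal edge; the Vershik map sends $x$ to its successor $\varphi_\omega(x)=y$,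 where $y_i=x_i$ for $i>n$, $y_n$ is the successor of $x_n$ among the edges with the same range, and $(y_0,\dots,y_{n-1})$ is the minimal path from $v_0$ to the source of $y_n$. This is a bijection $X_B\setminus X_{\max}(\omega)\to X_B\setminus X_{\min}(\omega)$. Invariant probability measures of $(X_B,\varphi_\omega)$ are the Borel probability measures on $X_B$ invariant with respect to the tail equivalence relation, i.e., for every vertex $v$ all cylinder sets defined by paths from $v_0$ to $v$ have equal measure; when $\boldsymbol\sigma$ is everywhere growing, $X_{\max}(\omega)$ and $X_{\min}(\omega)$ have measure zero for each such measure, so $\varphi_\omega$ is defined almost everywhere and $(X_B,\varphi_\omega)$ is regarded as a measurable dynamical system. Almost-conjugacy. A transformation $\Phi:(X,T)\to(Y,S)$ is an almost-conjugacy if there are a $T$-invariant set $\mathcal{D}\subset X$ and an $S$-invariant set $\mathcal{E}\subset Y$ such that $\Phi:X\setminus\mathcal{D}\to Y\setminus\mathcal{E}$ is a continuous bijection with $\Phi\circ T=S\circ\Phi$, and $\mathcal{D}$ (resp. $\mathcal{E}$) has measure zero for every fully supported invariant probability measure on $(X,T)$ (resp. $(Y,S)$). For $(X_B,\varphi_\omega)$ the exceptional set contains $X_{\max}(\omega)\cup X_{\min}(\omega)$, and its invariance means that $\varphi_\omega$ restricts to a bijection of its complement. Two systems are almost-conjugate if there is an almost-conjugacy between them. $(Y,S)$ is called an almost-factor of $(X,T)$ if there are a $T$-invariant set $\mathcal{D}\subset X$, an $S$-invariant set $\mathcal{E}\subset Y$ and a continuous surjection (not necessarily injective) $\Phi:X\setminus\mathcal{D}\to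 Y\setminus\mathcal{E}$ with $\Phi\circ T=S\circ\Phi$, such that $\mathcal{D}$ (resp. $\mathcal{E}$) has measure zero for every fully supported invariant probability measure on $(X,T)$ (resp. $(Y,S)$). *)

theory Defs
  imports "HOL-Probability.Probability" "HOL-Library.Sublist"
begin

section \<open>Sequences of morphisms\<close>

text \<open>
  The alphabets are finite subsets \<open>A n\<close> of one letter type, and \<open>\<sigma> n\<close> is a morphism from \<open>A (Suc n)\<close>
  to non-empty words over \<open>A n\<close>; values of \<open>\<sigma> n\<close> outside \<open>A (Suc n)\<close> are irrelevant.
\<close>

definition morphism_sequence :: "(nat \<Rightarrow> 'a set) \<Rightarrow> (nat \<Rightarrow> 'a \<Rightarrow> 'a list) \<Rightarrow> bool" where
  "morphism_sequence A \<sigma> \<longleftrightarrow>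
     (\<forall>n. finite (A n)) \<and> (\<forall>n. \<forall>a\<in>A (Suc n). \<sigma> n a \<noteq> [] \<and> set (\<sigma> n a) \<subseteq> A n)"

definition morph_word :: "('a \<Rightarrow> 'b list) \<Rightarrow> 'a list \<Rightarrow> 'b list" where
  "morph_word s w = concat (map s w)"

text \<open>\<open>morph_comp \<sigma> n N\<close> is \<open>\<sigma> n \<circ> \<dots> \<circ> \<sigma> (N - 1)\<close> acting on finite words.\<close>

definition morph_comp :: "(nat \<Rightarrow> 'a \<Rightarrow> 'a list) \<Rightarrow> nat \<Rightarrow> nat \<Rightarrow> 'a list \<Rightarrow> 'a list" where
  "morph_comp \<sigma> n N = foldr (\<circ>) (map (\<lambda>i. morph_word (\<sigma> i)) [n..<N]) id"

definition everywhere_growing :: "(nat \<Rightarrow> 'a set) \<Rightarrow> (nat \<Rightarrow> 'a \<Rightarrow> 'a list) \<Rightarrow> bool" where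
  "everywhere_growing A \<sigma> \<longleftrightarrow>
     filterlim (\<lambda>n. Min ((\<lambda>a. length (morph_comp \<sigma> 0 n [a])) ` A n)) at_top sequentially"

definition language :: "(nat \<Rightarrow> 'a set) \<Rightarrow> (nat \<Rightarrow> 'a \<Rightarrow> 'a list) \<Rightarrow> nat \<Rightarrow> 'a list set" where
  "language A \<sigma> n = {w \<in> lists (A n). \<exists>N>n. \<exists>a\<in>A N. sublist w (morph_comp \<sigma> n N [a])}"

definition sadic_shift :: "(nat \<Rightarrow> 'a set) \<Rightarrow> (nat \<Rightarrow> 'a \<Rightarrow> 'a list) \<Rightarrow> nat \<Rightarrow> (int \<Rightarrow> 'a) set" where
  "sadic_shift A \<sigma> n =
     {x. (\<forall>i. x i \<in> A n) \<and>
         (\<forall>i l. map (\<lambda>j. x (i + int j)) [0..<l] \<in> language A \<sigma> n)}"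

text \<open>The \<open>k\<close>-th power of the left shift, for any integer \<open>k\<close>.\<close>

definition shift_pow :: "int \<Rightarrow> (int \<Rightarrow> 'a) \<Rightarrow> int \<Rightarrow> 'a" where
  "shift_pow k x = (\<lambda>i. x (i + k))"

abbreviation left_shift :: "(int \<Rightarrow> 'a) \<Rightarrow> int \<Rightarrow> 'a" where
  "left_shift \<equiv> shift_pow 1"

section \<open>Recognizability\<close>

text \<open>\<open>block_start s x i\<close> is the index at which the block \<open>s (x i)\<close> begins in the image of \<open>x\<close>.\<close>

definition block_start :: "('a \<Rightarrow> 'b list) \<Rightarrow> (int \<Rightarrow> 'a) \<Rightarrow> int \<Rightarrow> int" where
  "block_start s x i =
     (if 0 \<le> i then (\<Sum>j\<in>{0..<i}. int (length (s (x j))))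
      else - (\<Sum>j\<in>{i..<0}. int (length (s (x j)))))"

definition morph_biinf :: "('a \<Rightarrow> 'b list) \<Rightarrow> (int \<Rightarrow> 'a) \<Rightarrow> int \<Rightarrow> 'b" where
  "morph_biinf s x = (\<lambda>m.
     let i = (THE i. block_start s x i \<le> m \<and> m < block_start s x (i + 1))
     in s (x i) ! nat (m - block_start s x i))"

definition is_representation :: "('a \<Rightarrow> 'b list) \<Rightarrow> (int \<Rightarrow> 'b) \<Rightarrow> int \<times> (int \<Rightarrow> 'a) \<Rightarrow> bool" where
  "is_representation s y = (\<lambda>(k, x). y = shift_pow k (morph_biinf s x))"

definition is_centered :: "('a \<Rightarrow> 'b list) \<Rightarrow> int \<times> (int \<Rightarrow> 'a) \<Rightarrow> bool" where
  "is_centered s = (\<lambda>(k, x). 0 \<le> k \<and> k < int (length (s (x 0))))"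

definition recognizable :: "(nat \<Rightarrow> 'a set) \<Rightarrow> (nat \<Rightarrow> 'a \<Rightarrow> 'a list) \<Rightarrow> bool" where
  "recognizable A \<sigma> \<longleftrightarrow>
     (\<forall>n. \<forall>y. (\<forall>i. y i \<in> A n) \<longrightarrow>
        (\<exists>\<^sub>\<le>\<^sub>1 p. is_representation (\<sigma> n) y p \<and> is_centered (\<sigma> n) p
                 \<and> snd p \<in> sadic_shift A \<sigma> (Suc n)))"

section \<open>The natural ordered Bratteli diagram\<close>

text \<open>
  Vertices are encoded as options: \<open>None\<close> is the root and \<open>Some a\<close>, with \<open>a \<in> A n\<close>, is a vertex of
  level \<open>Suc n\<close>. An edge is the pair of the letter of its range and its label.
\<close>

type_synonym 'a edge = "'a \<times> nat"

fun bv_vertices :: "(nat \<Rightarrow> 'a set) \<Rightarrow> nat \<Rightarrow> 'a option set" where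
  "bv_vertices A 0 = {None}"
| "bv_vertices A (Suc n) = Some ` A n"

fun bv_edges :: "(nat \<Rightarrow> 'a set) \<Rightarrow> (nat \<Rightarrow> 'a \<Rightarrow> 'a list) \<Rightarrow> nat \<Rightarrow> 'a edge set" where
  "bv_edges A \<sigma> 0 = {(a, j). a \<in> A 0 \<and> j = 0}"
| "bv_edges A \<sigma> (Suc n) = {(a, j). a \<in> A (Suc n) \<and> j < length (\<sigma> n a)}"

definition bv_range :: "'a edge \<Rightarrow> 'a option" where
  "bv_range e = Some (fst e)"

abbreviation bv_label :: "'a edge \<Rightarrow> nat" where
  "bv_label e \<equiv> snd e"

fun bv_source :: "(nat \<Rightarrow> 'a \<Rightarrow> 'a list) \<Rightarrow> nat \<Rightarrow> 'a edge \<Rightarrow> 'a option" where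
  "bv_source \<sigma> 0 e = None"
| "bv_source \<sigma> (Suc n) e = Some (\<sigma> n (fst e) ! bv_label e)"

definition bv_paths :: "(nat \<Rightarrow> 'a set) \<Rightarrow> (nat \<Rightarrow> 'a \<Rightarrow> 'a list) \<Rightarrow> (nat \<Rightarrow> 'a edge) set" where
  "bv_paths A \<sigma> =
     {x. \<forall>n. x n \<in> bv_edges A \<sigma> n \<and> bv_range (x n) = bv_source \<sigma> (Suc n) (x (Suc n))}"

definition bv_finite_path :: "(nat \<Rightarrow> 'a set) \<Rightarrow> (nat \<Rightarrow> 'a \<Rightarrow> 'a list) \<Rightarrow> 'a edge list \<Rightarrow> bool" where
  "bv_finite_path A \<sigma> p \<longleftrightarrow>
     (\<forall>i<length p. p ! i \<in> bv_edges A \<sigma> i) \<and>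
     (\<forall>i. Suc i < length p \<longrightarrow> bv_range (p ! i) = bv_source \<sigma> (Suc i) (p ! Suc i))"

definition bv_end :: "'a edge list \<Rightarrow> 'a option" where
  "bv_end p = (if p = [] then None else bv_range (last p))"

definition bv_paths_to ::
  "(nat \<Rightarrow> 'a set) \<Rightarrow> (nat \<Rightarrow> 'a \<Rightarrow> 'a list) \<Rightarrow> nat \<Rightarrow> 'a option \<Rightarrow> 'a edge list set" where
  "bv_paths_to A \<sigma> n v = {p. bv_finite_path A \<sigma> p \<and> length p = n \<and> bv_end p = v}"

definition bv_cylinder ::
  "(nat \<Rightarrow> 'a set) \<Rightarrow> (nat \<Rightarrow> 'a \<Rightarrow> 'a list) \<Rightarrow> 'a edge list \<Rightarrow> (nat \<Rightarrow> 'a edge) set" where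
  "bv_cylinder A \<sigma> p = {x \<in> bv_paths A \<sigma>. \<forall>i<length p. x i = p ! i}"

definition bv_topology ::
  "(nat \<Rightarrow> 'a set) \<Rightarrow> (nat \<Rightarrow> 'a \<Rightarrow> 'a list) \<Rightarrow> (nat \<Rightarrow> 'a edge) topology" where
  "bv_topology A \<sigma> = topology_generated_by {bv_cylinder A \<sigma> p | p. bv_finite_path A \<sigma> p}"

lemma topspace_bv_topology: "topspace (bv_topology A \<sigma>) = bv_paths A \<sigma>"
proof -
  have "bv_paths A \<sigma> \<in> {bv_cylinder A \<sigma> p | p. bv_finite_path A \<sigma> p}"
    by (rule CollectI, rule exI[of _ "[]"]) (simp add: bv_finite_path_def bv_cylinder_def)
  moreover have "bv_cylinder A \<sigma> p \<subseteq> bv_paths A \<sigma>" for p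
    by (auto simp: bv_cylinder_def)
  ultimately show ?thesis
    unfolding bv_topology_def topology_generated_by_topspace by blast
qed

definition bv_max_edge ::
  "(nat \<Rightarrow> 'a set) \<Rightarrow> (nat \<Rightarrow> 'a \<Rightarrow> 'a list) \<Rightarrow> nat \<Rightarrow> 'a edge \<Rightarrow> bool" where
  "bv_max_edge A \<sigma> n e \<longleftrightarrow>
     (\<forall>f\<in>bv_edges A \<sigma> n. bv_range f = bv_range e \<longrightarrow> bv_label f \<le> bv_label e)"

definition bv_min_edge ::
  "(nat \<Rightarrow> 'a set) \<Rightarrow> (nat \<Rightarrow> 'a \<Rightarrow> 'a list) \<Rightarrow> nat \<Rightarrow> 'a edge \<Rightarrow> bool" where
  "bv_min_edge A \<sigma> n e \<longleftrightarrow>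
     (\<forall>f\<in>bv_edges A \<sigma> n. bv_range f = bv_range e \<longrightarrow> bv_label e \<le> bv_label f)"

definition bv_succ_edge ::
  "(nat \<Rightarrow> 'a set) \<Rightarrow> (nat \<Rightarrow> 'a \<Rightarrow> 'a list) \<Rightarrow> nat \<Rightarrow> 'a edge \<Rightarrow> 'a edge \<Rightarrow> bool" where
  "bv_succ_edge A \<sigma> n e f \<longleftrightarrow>
     f \<in> bv_edges A \<sigma> n \<and> bv_range f = bv_range e \<and> bv_label e < bv_label f \<and>
     (\<forall>g\<in>bv_edges A \<sigma> n.
        bv_range g = bv_range e \<and> bv_label e < bv_label g \<longrightarrow> bv_label f \<le> bv_label g)"

definition bv_max_paths ::
  "(nat \<Rightarrow> 'a set) \<Rightarrow> (nat \<Rightarrow> 'a \<Rightarrow> 'a list) \<Rightarrow> (nat \<Rightarrow> 'a edge) set" where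
  "bv_max_paths A \<sigma> = {x \<in> bv_paths A \<sigma>. \<forall>n. bv_max_edge A \<sigma> n (x n)}"

definition bv_min_paths ::
  "(nat \<Rightarrow> 'a set) \<Rightarrow> (nat \<Rightarrow> 'a \<Rightarrow> 'a list) \<Rightarrow> (nat \<Rightarrow> 'a edge) set" where
  "bv_min_paths A \<sigma> = {x \<in> bv_paths A \<sigma>. \<forall>n. bv_min_edge A \<sigma> n (x n)}"

text \<open>
  The requirement \<open>y \<in> bv_paths A \<sigma>\<close> makes the initial segment of \<open>y\<close> a path from the root to the source
  of \<open>y n\<close>. Every non-maximal path has exactly one successor; \<open>vershik_map\<close> is unspecified on maximal
  paths.
\<close>

definition vershik_successor ::
  "(nat \<Rightarrow> 'a set) \<Rightarrow> (nat \<Rightarrow> 'a \<Rightarrow> 'a list) \<Rightarrow> (nat \<Rightarrow> 'a edge) \<Rightarrow> (nat \<Rightarrow> 'a edge) \<Rightarrow> bool" where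
  "vershik_successor A \<sigma> x y \<longleftrightarrow>
     y \<in> bv_paths A \<sigma> \<and>
     (\<exists>n. \<not> bv_max_edge A \<sigma> n (x n) \<and> (\<forall>i<n. bv_max_edge A \<sigma> i (x i)) \<and>
          (\<forall>i>n. y i = x i) \<and> bv_succ_edge A \<sigma> n (x n) (y n) \<and>
          (\<forall>i<n. bv_min_edge A \<sigma> i (y i)))"

definition vershik_map ::
  "(nat \<Rightarrow> 'a set) \<Rightarrow> (nat \<Rightarrow> 'a \<Rightarrow> 'a list) \<Rightarrow> (nat \<Rightarrow> 'a edge) \<Rightarrow> (nat \<Rightarrow> 'a edge)" where
  "vershik_map A \<sigma> x = (THE y. vershik_successor A \<sigma> x y)"

section \<open>Dynamical systems, almost-factors and almost-conjugacies\<close>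

definition borel_of :: "'x topology \<Rightarrow> 'x measure" where
  "borel_of X = sigma (topspace X) {U. openin X U}"

text \<open>
  A system consists of a topological space, a map, the set of singular points that every exceptional
  set has to contain (empty for a homeomorphism), and the set of its invariant probability measures.
\<close>

record 'x system =
  sys_top :: "'x topology"
  sys_map :: "'x \<Rightarrow> 'x"
  sys_sing :: "'x set"
  sys_inv :: "'x measure set"

definition fully_supported :: "'x topology \<Rightarrow> 'x measure \<Rightarrow> bool" where
  "fully_supported X \<mu> \<longleftrightarrow> (\<forall>U. openin X U \<and> U \<noteq> {} \<longrightarrow> emeasure \<mu> U > 0)"

definition invariant_set :: "'x system \<Rightarrow> 'x set \<Rightarrow> bool" where
  "invariant_set S D \<longleftrightarrow>
     D \<subseteq> topspace (sys_top S) \<and> sys_sing S \<subseteq> D \<and>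
     bij_betw (sys_map S) (topspace (sys_top S) - D) (topspace (sys_top S) - D)"

lemma invariant_set_iff_image_eq:
  assumes "bij_betw (sys_map S) (topspace (sys_top S)) (topspace (sys_top S))"
    and "sys_sing S = {}" and "D \<subseteq> topspace (sys_top S)"
  shows "invariant_set S D \<longleftrightarrow> sys_map S ` D = D"
proof -
  let ?X = "topspace (sys_top S)"
  have inj: "inj_on (sys_map S) ?X" and im: "sys_map S ` ?X = ?X"
    using assms(1) by (auto simp: bij_betw_def)
  have diff: "sys_map S ` (?X - C) = ?X - sys_map S ` C" if "C \<subseteq> ?X" for C
    using inj_on_image_set_diff[OF inj, of ?X C] that im by auto
  have sub: "sys_map S ` D \<subseteq> ?X"
    using im assms(3) by blast
  have "bij_betw (sys_map S) (?X - D) (?X - D) \<longleftrightarrow> sys_map S ` (?X - D) = ?X - D"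
    using inj by (auto simp: bij_betw_def intro: inj_on_subset)
  also have "\<dots> \<longleftrightarrow> ?X - sys_map S ` D = ?X - D"
    by (simp add: diff assms(3))
  also have "\<dots> \<longleftrightarrow> sys_map S ` D = D"
    using sub assms(3) by blast
  finally show ?thesis
    using assms by (simp add: invariant_set_def)
qed

text \<open>
  An exceptional set need not be Borel, so measure zero refers to the completion. A bare
  \<open>emeasure \<mu> D = 0\<close> would hold for every non-measurable set.
\<close>

definition exceptional_set :: "'x system \<Rightarrow> 'x set \<Rightarrow> bool" where
  "exceptional_set S D \<longleftrightarrow>
     invariant_set S D \<and>
     (\<forall>\<mu>\<in>sys_inv S. fully_supported (sys_top S) \<mu> \<longrightarrow> D \<in> null_sets (completion \<mu>))"

definition almost_factor_map :: "'x system \<Rightarrow> 'y system \<Rightarrow> ('x \<Rightarrow> 'y) \<Rightarrow> bool" where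
  "almost_factor_map S R \<Phi> \<longleftrightarrow>
     (\<exists>D E. exceptional_set S D \<and> exceptional_set R E \<and>
        continuous_map (subtopology (sys_top S) (topspace (sys_top S) - D))
                       (subtopology (sys_top R) (topspace (sys_top R) - E)) \<Phi> \<and>
        \<Phi> ` (topspace (sys_top S) - D) = topspace (sys_top R) - E \<and>
        (\<forall>x\<in>topspace (sys_top S) - D. \<Phi> (sys_map S x) = sys_map R (\<Phi> x)))"

definition almost_conjugacy :: "'x system \<Rightarrow> 'y system \<Rightarrow> ('x \<Rightarrow> 'y) \<Rightarrow> bool" where
  "almost_conjugacy S R \<Phi> \<longleftrightarrow>
     (\<exists>D E. exceptional_set S D \<and> exceptional_set R E \<and>
        continuous_map (subtopology (sys_top S) (topspace (sys_top S) - D))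
                       (subtopology (sys_top R) (topspace (sys_top R) - E)) \<Phi> \<and>
        bij_betw \<Phi> (topspace (sys_top S) - D) (topspace (sys_top R) - E) \<and>
        (\<forall>x\<in>topspace (sys_top S) - D. \<Phi> (sys_map S x) = sys_map R (\<Phi> x)))"

definition is_almost_factor_of :: "'y system \<Rightarrow> 'x system \<Rightarrow> bool" where
  "is_almost_factor_of R S \<longleftrightarrow> (\<exists>\<Phi>. almost_factor_map S R \<Phi>)"

text \<open>The inverse of an almost-conjugacy need not be continuous, hence both directions.\<close>

definition almost_conjugate :: "'x system \<Rightarrow> 'y system \<Rightarrow> bool" where
  "almost_conjugate S R \<longleftrightarrow> (\<exists>\<Phi>. almost_conjugacy S R \<Phi>) \<or> (\<exists>\<Phi>. almost_conjugacy R S \<Phi>)"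

section \<open>The two systems\<close>

definition sadic_topology ::
  "(nat \<Rightarrow> 'a set) \<Rightarrow> (nat \<Rightarrow> 'a \<Rightarrow> 'a list) \<Rightarrow> (int \<Rightarrow> 'a) topology" where
  "sadic_topology A \<sigma> =
     subtopology (product_topology (\<lambda>_. discrete_topology (A 0)) UNIV) (sadic_shift A \<sigma> 0)"

lemma topspace_sadic_topology: "topspace (sadic_topology A \<sigma>) = sadic_shift A \<sigma> 0"
  by (auto simp: sadic_topology_def sadic_shift_def)

definition sadic_system ::
  "(nat \<Rightarrow> 'a set) \<Rightarrow> (nat \<Rightarrow> 'a \<Rightarrow> 'a list) \<Rightarrow> (int \<Rightarrow> 'a) system" where
  "sadic_system A \<sigma> =
     \<lparr>sys_top = sadic_topology A \<sigma>, sys_map = left_shift, sys_sing = {},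
      sys_inv = {\<mu>. prob_space \<mu> \<and> sets \<mu> = sets (borel_of (sadic_topology A \<sigma>)) \<and>
                    (\<forall>B\<in>sets \<mu>. emeasure \<mu> (left_shift -` B \<inter> space \<mu>) = emeasure \<mu> B)}\<rparr>"

text \<open>Invariance of measures on the path space is invariance under the tail equivalence relation.\<close>

definition bratteli_vershik_system ::
  "(nat \<Rightarrow> 'a set) \<Rightarrow> (nat \<Rightarrow> 'a \<Rightarrow> 'a list) \<Rightarrow> (nat \<Rightarrow> 'a edge) system" where
  "bratteli_vershik_system A \<sigma> =
     \<lparr>sys_top = bv_topology A \<sigma>, sys_map = vershik_map A \<sigma>,
      sys_sing = bv_max_paths A \<sigma> \<union> bv_min_paths A \<sigma>,
      sys_inv = {\<mu>. prob_space \<mu> \<and> sets \<mu> = sets (borel_of (bv_topology A \<sigma>)) \<and>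
                    (\<forall>n. \<forall>v\<in>bv_vertices A n. \<forall>p\<in>bv_paths_to A \<sigma> n v. \<forall>q\<in>bv_paths_to A \<sigma> n v.
                       emeasure \<mu> (bv_cylinder A \<sigma> p) = emeasure \<mu> (bv_cylinder A \<sigma> q))}\<rparr>"

end

theory Submission
  imports Defs
begin

text \<open>
  A path \<open>x\<close> through the vertices \<open>a\<^sub>0, a\<^sub>1, \<dots>\<close> is read as a nested sequence of occurrences of
  \<open>\<sigma>\<^bsub>[0,n)\<^esub>(a\<^sub>n)\<close> around the origin. If \<open>x\<close> has infinitely many non-minimal and infinitely many
  non-maximal edges, these windows exhaust \<open>\<int>\<close> and define a point of the shift; the Vershik map moves
  the origin by one. This is the almost-factor map.

  The other paths form a null set: for fixed \<open>j\<close> and large \<open>n\<close>, the set of paths whose origin is the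
  \<open>j\<close>-th letter of the level \<open>n\<close> window has measure at most \<open>1 / min\<^sub>a |\<sigma>\<^bsub>[0,n)\<^esub>(a)|\<close>.

  For the points \<open>y\<close> of the shift that come from no such path, recognizability is not available, so a
  counting argument along orbits is used. Given \<open>\<epsilon>\<close>, choose levels \<open>h i\<close> growing so fast that in any
  desubstitution of \<open>y\<close> the positions at distance less than \<open>i\<close> from a boundary of a level \<open>h i\<close> window
  have density at most \<open>\<epsilon> / 2\<^sup>i\<close>. Then most shifts of \<open>y\<close> admit a desubstitution up to any level \<open>N\<close>
  in which the origin is far from all these boundaries; by invariance the points with this property
  have measure at least \<open>1 - \<epsilon>\<close>, and by Koenig's lemma a point that has it for every \<open>N\<close> is the image of a path.

  If the sequence is recognizable, all levels of the path can be recovered successively from its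
  word, so the map is injective.
\<close>

section \<open>Words and combinatorics\<close>

lemma foldr_comp_append:
  "foldr (\<circ>) (fs @ gs) id = foldr (\<circ>) fs id \<circ> foldr (\<circ>) gs id"
  by (induction fs) auto

lemma morph_comp_trivial [simp]: "morph_comp \<sigma> n n w = w"
  by (simp add: morph_comp_def)

lemma morph_comp_compose:
  assumes "m \<le> k" "k \<le> n"
  shows "morph_comp \<sigma> m n w = morph_comp \<sigma> m k (morph_comp \<sigma> k n w)"
proof -
  have "[m..<n] = [m..<k] @ [k..<n]"
    using assms upt_add_eq_append[of m k "n - k"] by simp
  then show ?thesis
    by (simp add: morph_comp_def foldr_comp_append del: foldr_append)
qed

lemma morph_comp_single: "morph_comp \<sigma> n (Suc n) w = morph_word (\<sigma> n) w"
  by (simp add: morph_comp_def)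

lemma morph_comp_Suc:
  "m \<le> n \<Longrightarrow> morph_comp \<sigma> m (Suc n) w = morph_comp \<sigma> m n (morph_word (\<sigma> n) w)"
  using morph_comp_compose[of m n "Suc n" \<sigma> w] by (simp add: morph_comp_single)

lemma morph_comp_append [simp]:
  "morph_comp \<sigma> m n (u @ v) = morph_comp \<sigma> m n u @ morph_comp \<sigma> m n v"
proof -
  have "foldr (\<circ>) (map (\<lambda>i. morph_word (\<sigma> i)) is) id (u @ v) =
    foldr (\<circ>) (map (\<lambda>i. morph_word (\<sigma> i)) is) id u @
    foldr (\<circ>) (map (\<lambda>i. morph_word (\<sigma> i)) is) id v" for "is"
    by (induction "is") (auto simp: morph_word_def)
  then show ?thesis
    by (simp add: morph_comp_def)
qed

lemma morph_comp_Nil [simp]: "morph_comp \<sigma> m n [] = []"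
  using morph_comp_append[of \<sigma> m n "[]" "[]"] by simp

lemma morph_comp_letter_Suc:
  "m \<le> n \<Longrightarrow> morph_comp \<sigma> m (Suc n) [a] = morph_comp \<sigma> m n (\<sigma> n a)"
  by (simp add: morph_comp_Suc morph_word_def)

lemma length_morph_comp_take_mono:
  "i \<le> j \<Longrightarrow> length (morph_comp \<sigma> m n (take i w)) \<le> length (morph_comp \<sigma> m n (take j w))"
  by (metis add_leD1 le_add_diff_inverse length_append morph_comp_append take_add order_refl)

text \<open>The image of the letter at \<open>i\<close> lies between the two cuts. This separation
  yields uniqueness of segments and the gaps in the counting argument.\<close>

lemma length_morph_comp_take_less:
  assumes "i < j" "j \<le> length w"
  shows "length (morph_comp \<sigma> m n (take i w)) + length (morph_comp \<sigma> m n [w ! i])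
    \<le> length (morph_comp \<sigma> m n (take j w))"
proof -
  have "take (Suc i) w = take i w @ [w ! i]"
    using assms by (simp add: take_Suc_conv_app_nth)
  then have "length (morph_comp \<sigma> m n (take i w)) + length (morph_comp \<sigma> m n [w ! i])
    = length (morph_comp \<sigma> m n (take (Suc i) w))"
    by simp
  also have "\<dots> \<le> length (morph_comp \<sigma> m n (take j w))"
    using assms by (intro length_morph_comp_take_mono) simp
  finally show ?thesis .
qed

text \<open>Division with remainder by blocks: \<open>j\<close> is the block containing
  \<open>q\<close>, and \<open>r\<close> the offset in it. Induction from the right only has to
  decide whether \<open>q\<close> falls into the last block.\<close>

lemma morph_comp_locate:
  assumes "q < length (morph_comp \<sigma> m n w)"
  shows "\<exists>j<length w. \<exists>r<length (morph_comp \<sigma> m n [w ! j]).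
           q = length (morph_comp \<sigma> m n (take j w)) + r"
  using assms
proof (induction w rule: rev_induct)
  case (snoc a w)
  show ?case
  proof (cases "q < length (morph_comp \<sigma> m n w)")
    case True
    then obtain j r where "j < length w" "r < length (morph_comp \<sigma> m n [w ! j])"
      "q = length (morph_comp \<sigma> m n (take j w)) + r"
      using snoc.IH by blast
    then show ?thesis
      by (intro exI[of _ j] conjI exI[of _ r]) (auto simp: nth_append)
  next
    case False
    with snoc.prems show ?thesis
      by (intro exI[of _ "length w"] conjI exI[of _ "q - length (morph_comp \<sigma> m n w)"]) auto
  qed
qed simp

section \<open>Block boundaries of bi-infinite images\<close>

lemma block_start_Suc:
  "block_start s x (i + 1) = block_start s x i + int (length (s (x i)))"
proof -
  consider "i \<ge> 0" | "i = -1" | "i < -1" by linarith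
  then show ?thesis
  proof cases
    case 1
    then have "{0..<i + 1} = insert i {0..<i}" by auto
    with 1 show ?thesis by (simp add: block_start_def)
  next
    case 2
    then have "{i..<0} = {-1}" by auto
    with 2 show ?thesis by (simp add: block_start_def)
  next
    case 3
    then have "{i..<0} = insert i {i + 1..<0}" by auto
    with 3 show ?thesis by (simp add: block_start_def)
  qed
qed

lemma block_start_mono: "i \<le> j \<Longrightarrow> block_start s x i \<le> block_start s x j"
  by (induction j rule: int_ge_induct) (auto simp: block_start_Suc)

lemma morph_biinf_eq:
  assumes "block_start s x i \<le> m" "m < block_start s x (i + 1)"
  shows "morph_biinf s x m = s (x i) ! nat (m - block_start s x i)"
proof -
  have "j = i" if "block_start s x j \<le> m" "m < block_start s x (j + 1)" for j
  proof (rule ccontr)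
    assume "j \<noteq> i"
    then consider "j + 1 \<le> i" | "i + 1 \<le> j" by linarith
    then show False
      by cases (use assms that block_start_mono[of "j + 1" i s x] block_start_mono[of "i + 1" j s x] in linarith)+
  qed
  then have "(THE j. block_start s x j \<le> m \<and> m < block_start s x (j + 1)) = i"
    using assms by (intro the_equality) blast+
  then show ?thesis
    by (simp add: morph_biinf_def)
qed

text \<open>Here \<open>x\<close> shows the word \<open>w\<close> with position \<open>r\<close> of
  \<open>w\<close> at the origin. One more letter adds the same length to both sides, so their
  difference is constant in \<open>d\<close>; it is evaluated at \<open>d = r\<close>, where the
  boundary is 0.\<close>

lemma block_start_window:
  assumes "\<And>d. d < length w \<Longrightarrow> x (int d - int r) = w ! d" "r \<le> length w" "d \<le> length w"
  shows "block_start s x (int d - int r) =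
    int (length (morph_word s (take d w))) - int (length (morph_word s (take r w)))"
proof -
  have "block_start s x (int d - int r) - int (length (morph_word s (take d w))) =
      block_start s x (- int r)" if "d \<le> length w" for d
    using that
  proof (induction d)
    case (Suc d)
    then have "block_start s x (int (Suc d) - int r) =
        block_start s x (int d - int r) + int (length (s (w ! d)))"
      using block_start_Suc[of s x "int d - int r"] assms(1)[of d] by (simp add: algebra_simps)
    with Suc show ?case
      by (simp add: take_Suc_conv_app_nth morph_word_def)
  qed (simp add: morph_word_def)
  from this[of d] this[of r] show ?thesis
    using assms(2,3) by (simp add: block_start_def)
qed

text \<open>Pigeonhole: separated elements have different quotients by \<open>g\<close>, and at most
  \<open>L div g + 1\<close> quotients occur.\<close>

lemma card_separated_le:
  fixes S :: "nat set"
  assumes "S \<subseteq> {..<L}" "g > 0" "\<And>m n. m \<in> S \<Longrightarrow> n \<in> S \<Longrightarrow> m < n \<Longrightarrow> m + g \<le> n"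
  shows "real (card S) \<le> real L / real g + 1"
proof -
  have less: "m div g < n div g" if "m \<in> S" "n \<in> S" "m < n" for m n
  proof -
    have "Suc (m div g) = (m + g) div g"
      using assms(2) by simp
    also have "\<dots> \<le> n div g"
      using assms(3)[OF that] by (rule div_le_mono)
    finally show ?thesis by simp
  qed
  have "inj_on (\<lambda>m. m div g) S"
    by (rule inj_onI) (metis less less_irrefl linorder_neqE_nat)
  moreover have "(\<lambda>m. m div g) ` S \<subseteq> {..L div g}"
    using assms(1) by (auto intro!: div_le_mono)
  ultimately have "card S \<le> card {..L div g}"
    by (intro card_inj_on_le[of "\<lambda>m. m div g"]) auto
  then have "real (card S) \<le> real (L div g) + 1"
    by simp
  also have "real (L div g) \<le> real L / real g"
    by (rule of_nat_div_le_of_nat)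
  finally show ?thesis by simp
qed

text \<open>Compactness: a prefix is kept if for every \<open>N\<close> it continues to a solution
  of \<open>R N\<close>. Since each place admits finitely many values, a kept prefix has a kept
  extension, and the limit of such prefixes solves every \<open>R N\<close>.\<close>

lemma koenig:
  fixes R :: "nat \<Rightarrow> (nat \<Rightarrow> 'b) \<Rightarrow> bool"
  assumes ex: "\<And>N. \<exists>x. R N x" and mono: "\<And>M N x. M \<le> N \<Longrightarrow> R N x \<Longrightarrow> R M x"
    and local: "\<And>N x y. (\<And>i. i \<le> N \<Longrightarrow> x i = y i) \<Longrightarrow> R N x \<Longrightarrow> R N y"
    and fin: "\<And>i. finite (F i)" and F: "\<And>N x. R N x \<Longrightarrow> x N \<in> F N"
  shows "\<exists>x. \<forall>N. R N x"
proof -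
  define ext where "ext n x \<longleftrightarrow> (\<forall>N. \<exists>z. R N z \<and> (\<forall>i<n. z i = x i))" for n x
  have step: "\<exists>y. ext (Suc n) y \<and> (\<forall>i<n. y i = x i)" if x: "ext n x" for n x
  proof (rule ccontr)
    assume neg: "\<not> ?thesis"
    have "\<exists>N. \<forall>z. R N z \<longrightarrow> (\<exists>i<Suc n. z i \<noteq> (x(n := e)) i)" for e
    proof -
      have "\<not> ext (Suc n) (x(n := e))"
        using neg by (auto dest: spec[of _ "x(n := e)"])
      then show ?thesis
        unfolding ext_def by blast
    qed
    then obtain M where M: "\<And>e z. R (M e) z \<Longrightarrow> \<exists>i<Suc n. z i \<noteq> (x(n := e)) i"
      by metis
    \<comment> \<open>A level past every failure level \<open>M e\<close> with
      \<open>e \<in> F n\<close>; a continuation solving \<open>R N\<close> contradicts the failure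
      of its own value at \<open>n\<close>.\<close>
    define N where "N = max n (Max (M ` F n))"
    obtain z where z: "R N z" "\<And>i. i < n \<Longrightarrow> z i = x i"
      using x unfolding ext_def by blast
    have "z n \<in> F n"
      using mono[OF _ z(1), of n] F by (simp add: N_def)
    then have "M (z n) \<le> N"
      using fin[of n] by (auto simp: N_def intro!: max.coboundedI2 Max_ge)
    then have "R (M (z n)) z"
      using mono z(1) by blast
    from M[OF this] z(2) show False
      by (auto simp: less_Suc_eq split: if_splits)
  qed
  have "ext 0 x" for x
    using ex by (simp add: ext_def)
  then have "\<exists>X. \<forall>n. ext n (X n) \<and> (\<forall>i<n. X (Suc n) i = X n i)"
    by (intro dependent_nat_choice step) auto
  then obtain X where X: "\<And>n. ext n (X n)" "\<And>n i. i < n \<Longrightarrow> X (Suc n) i = X n i"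
    by blast
  have stable: "X n i = X (Suc i) i" if "n \<ge> Suc i" for n i
    using that by (induction n rule: dec_induct) (use X(2) in auto)
  have "R N (\<lambda>i. X (Suc i) i)" for N
  proof -
    obtain z where z: "R N z" "\<And>i. i < Suc N \<Longrightarrow> z i = X (Suc N) i"
      using X(1)[of "Suc N"] unfolding ext_def by blast
    show ?thesis
    proof (rule local[OF _ z(1)])
      fix i assume "i \<le> N"
      then show "z i = X (Suc i) i"
        using z(2)[of i] stable[of i "Suc N"] by simp
    qed
  qed
  then show ?thesis by blast
qed

lemma sets_borel_of_openin: "openin X U \<Longrightarrow> U \<in> sets (borel_of X)"
  unfolding borel_of_def using openin_subset by (subst sets_measure_of) auto

lemma space_borel_of: "space (borel_of X) = topspace X"
  unfolding borel_of_def using openin_subset by (subst space_measure_of) auto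

section \<open>Paths of the Bratteli diagram\<close>

locale morph_seq =
  fixes A :: "nat \<Rightarrow> 'a set" and \<sigma> :: "nat \<Rightarrow> 'a \<Rightarrow> 'a list"
  assumes morph: "morphism_sequence A \<sigma>"
begin

abbreviation wd :: "nat \<Rightarrow> nat \<Rightarrow> 'a \<Rightarrow> 'a list" where
  "wd m n a \<equiv> morph_comp \<sigma> m n [a]"

lemma finite_alphabet: "finite (A n)"
  using morph by (simp add: morphism_sequence_def)

lemma morph_nonempty: "a \<in> A (Suc n) \<Longrightarrow> \<sigma> n a \<noteq> []"
  and morph_letters: "a \<in> A (Suc n) \<Longrightarrow> set (\<sigma> n a) \<subseteq> A n"
  using morph by (auto simp: morphism_sequence_def)

lemma morph_comp_letters:
  assumes "m \<le> n" "set w \<subseteq> A n"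
  shows "set (morph_comp \<sigma> m n w) \<subseteq> A m"
  using assms
proof (induction n arbitrary: w rule: dec_induct)
  case (step n)
  have "set (morph_word (\<sigma> n) w) \<subseteq> A n"
    using step.prems morph_letters by (fastforce simp: morph_word_def)
  then show ?case
    using step by (simp add: morph_comp_Suc)
qed simp

lemma length_morph_comp_ge:
  assumes "m \<le> n" "set w \<subseteq> A n"
  shows "length w \<le> length (morph_comp \<sigma> m n w)"
  using assms
proof (induction n arbitrary: w rule: dec_induct)
  case (step n)
  have "set (morph_word (\<sigma> n) w) \<subseteq> A n"
    using step.prems morph_letters by (fastforce simp: morph_word_def)
  then have "length (morph_word (\<sigma> n) w) \<le> length (morph_comp \<sigma> m (Suc n) w)"
    using step by (simp add: morph_comp_Suc)
  moreover have "length w \<le> length (morph_word (\<sigma> n) w)"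
    using step.prems
  proof (induction w)
    case (Cons a w)
    then have "length (\<sigma> n a) > 0" "length w \<le> length (morph_word (\<sigma> n) w)"
      using morph_nonempty by auto
    then show ?case
      unfolding morph_word_def list.map concat.simps length_append list.size by linarith
  qed simp
  ultimately show ?case
    by simp
qed simp

subsection \<open>Path segments and positions\<close>

text \<open>A finite path is stored as an infinite sequence whose entries beyond \<open>n\<close>
  are ignored, so that restriction and splicing need no lists.\<close>

definition seg :: "nat \<Rightarrow> (nat \<Rightarrow> 'a edge) \<Rightarrow> bool" where
  "seg n x \<longleftrightarrow> (\<forall>i\<le>n. x i \<in> bv_edges A \<sigma> i) \<and>
     (\<forall>i<n. bv_range (x i) = bv_source \<sigma> (Suc i) (x (Suc i)))"

lemma bv_paths_iff_seg: "x \<in> bv_paths A \<sigma> \<longleftrightarrow> (\<forall>n. seg n x)"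
  by (auto simp: bv_paths_def seg_def)

lemma seg_mono: "seg n x \<Longrightarrow> m \<le> n \<Longrightarrow> seg m x"
  by (auto simp: seg_def)

lemma seg_cong: "(\<And>i. i \<le> n \<Longrightarrow> x i = y i) \<Longrightarrow> seg n x \<longleftrightarrow> seg n y"
  by (simp add: seg_def Suc_le_eq)

lemma seg_0_iff: "seg 0 x \<longleftrightarrow> fst (x 0) \<in> A 0 \<and> snd (x 0) = 0"
  by (cases "x 0") (auto simp: seg_def)

lemma seg_Suc_iff:
  "seg (Suc n) x \<longleftrightarrow> seg n x \<and> fst (x (Suc n)) \<in> A (Suc n) \<and>
     snd (x (Suc n)) < length (\<sigma> n (fst (x (Suc n)))) \<and>
     fst (x n) = \<sigma> n (fst (x (Suc n))) ! snd (x (Suc n))"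
  by (cases "x (Suc n)")
     (auto simp: seg_def bv_range_def le_Suc_eq less_Suc_eq)

lemma seg_letter: "seg n x \<Longrightarrow> i \<le> n \<Longrightarrow> fst (x i) \<in> A i"
  using seg_mono[of n x i] by (cases i) (auto simp: seg_0_iff seg_Suc_iff)

text \<open>The edge \<open>x (Suc i)\<close> selects one letter of the block
  \<open>\<sigma> i (fst (x (Suc i)))\<close>; \<open>pre\<close> and \<open>post\<close> are what
  stands to its left and right. They are indexed by the level of the selected letter.\<close>

definition pre :: "(nat \<Rightarrow> 'a edge) \<Rightarrow> nat \<Rightarrow> 'a list" where
  "pre x i = take (snd (x (Suc i))) (\<sigma> i (fst (x (Suc i))))"

definition post :: "(nat \<Rightarrow> 'a edge) \<Rightarrow> nat \<Rightarrow> 'a list" where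
  "post x i = drop (Suc (snd (x (Suc i)))) (\<sigma> i (fst (x (Suc i))))"

text \<open>In \<open>wd m n (fst (x n))\<close>, the letter \<open>fst (x m)\<close> that the path passes through has \<open>pos x m n\<close>
  letters to its left and \<open>rpos x m n\<close> letters to its right.\<close>

definition pos :: "(nat \<Rightarrow> 'a edge) \<Rightarrow> nat \<Rightarrow> nat \<Rightarrow> nat" where
  "pos x m n = (\<Sum>i=m..<n. length (morph_comp \<sigma> m i (pre x i)))"

definition rpos :: "(nat \<Rightarrow> 'a edge) \<Rightarrow> nat \<Rightarrow> nat \<Rightarrow> nat" where
  "rpos x m n = (\<Sum>i=m..<n. length (morph_comp \<sigma> m i (post x i)))"

lemma pos_refl [simp]: "pos x n n = 0" and rpos_refl [simp]: "rpos x n n = 0"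
  by (simp_all add: pos_def rpos_def)

lemma pos_Suc: "m \<le> n \<Longrightarrow> pos x m (Suc n) = length (morph_comp \<sigma> m n (pre x n)) + pos x m n"
  and rpos_Suc: "m \<le> n \<Longrightarrow> rpos x m (Suc n) = length (morph_comp \<sigma> m n (post x n)) + rpos x m n"
  by (simp_all add: pos_def rpos_def)

lemma pos_cong: "(\<And>i. i \<le> n \<Longrightarrow> x i = y i) \<Longrightarrow> pos x m n = pos y m n"
  and rpos_cong: "(\<And>i. i \<le> n \<Longrightarrow> x i = y i) \<Longrightarrow> rpos x m n = rpos y m n"
  by (auto simp: pos_def rpos_def pre_def post_def intro!: sum.cong)

lemma pos_mono: "n \<le> k \<Longrightarrow> pos x m n \<le> pos x m k"
  and rpos_mono: "n \<le> k \<Longrightarrow> rpos x m n \<le> rpos x m k"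
  by (auto simp: pos_def rpos_def intro!: sum_mono2)

lemma morph_split:
  assumes "seg (Suc n) x"
  shows "\<sigma> n (fst (x (Suc n))) = pre x n @ [fst (x n)] @ post x n"
  using assms by (simp add: seg_Suc_iff pre_def post_def id_take_nth_drop)

lemma pre_letters: "seg (Suc n) x \<Longrightarrow> set (pre x n) \<subseteq> A n"
  and post_letters: "seg (Suc n) x \<Longrightarrow> set (post x n) \<subseteq> A n"
  using morph_split[of n x] morph_letters[of "fst (x (Suc n))" n] seg_letter[of "Suc n" x "Suc n"]
  by auto

lemma wd_Suc_split:
  assumes "m \<le> n" "seg (Suc n) x"
  shows "wd m (Suc n) (fst (x (Suc n))) =
    morph_comp \<sigma> m n (pre x n) @ wd m n (fst (x n)) @ morph_comp \<sigma> m n (post x n)"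
  using assms(1) morph_split[OF assms(2)] by (simp add: morph_comp_letter_Suc flip: morph_comp_append)

text \<open>Iterating \<open>wd_Suc_split\<close> wraps the level \<open>n\<close> window in the
  images of the successive prefixes and suffixes, which form \<open>u\<close> and
  \<open>v\<close>.\<close>

lemma wd_nested:
  assumes "m \<le> n" "n \<le> k" "seg k x"
  shows "\<exists>u v. wd m k (fst (x k)) = u @ wd m n (fst (x n)) @ v \<and>
           pos x m k = length u + pos x m n \<and> rpos x m k = length v + rpos x m n"
  using assms(2,1,3)
proof (induction k rule: dec_induct)
  case (step k)
  then obtain u v where uv: "wd m k (fst (x k)) = u @ wd m n (fst (x n)) @ v"
     "pos x m k = length u + pos x m n" "rpos x m k = length v + rpos x m n"
    using seg_mono[of "Suc k" x k] by auto
  have "m \<le> k" using step by simp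
  then show ?case
    using wd_Suc_split[OF \<open>m \<le> k\<close> step.prems(2)] uv
    by (intro exI[of _ "morph_comp \<sigma> m k (pre x k) @ u"] exI[of _ "v @ morph_comp \<sigma> m k (post x k)"])
       (simp add: pos_Suc rpos_Suc)
qed auto

lemma length_wd:
  assumes "m \<le> n" "seg n x"
  shows "length (wd m n (fst (x n))) = pos x m n + rpos x m n + 1"
  using wd_nested[OF order_refl assms] by auto

lemma nth_wd_nested:
  assumes "m \<le> n" "n \<le> k" "seg k x" "t < length (wd m n (fst (x n)))"
  shows "wd m k (fst (x k)) ! (pos x m k - pos x m n + t) = wd m n (fst (x n)) ! t"
  using wd_nested[OF assms(1-3)] assms(4) by (auto simp: nth_append)

lemma nth_wd_pos:
  assumes "m \<le> n" "seg n x"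
  shows "wd m n (fst (x n)) ! pos x m n = fst (x m)"
  using nth_wd_nested[OF order_refl assms, of 0] by simp

text \<open>The letters to the left consist of the complete level \<open>k\<close> blocks before the
  current one and the part of the current block before the position.\<close>

lemma pos_split:
  assumes "m \<le> k" "k \<le> n" "seg n x"
  shows "pos x m n = length (morph_comp \<sigma> m k (take (pos x k n) (wd k n (fst (x n))))) + pos x m k"
  using assms(2,1,3)
proof (induction n rule: dec_induct)
  case (step n)
  have "take (pos x k (Suc n)) (wd k (Suc n) (fst (x (Suc n)))) =
      morph_comp \<sigma> k n (pre x n) @ take (pos x k n) (wd k n (fst (x n)))"
    using wd_Suc_split[of k n x] length_wd[of k n x] seg_mono[of "Suc n" x n] step
    by (simp add: pos_Suc)
  then show ?case
    using step seg_mono[of "Suc n" x n] morph_comp_compose[of m k n \<sigma> "pre x n"]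
    by (simp add: pos_Suc)
qed simp

text \<open>Desubstitution: the block of \<open>\<sigma> n b\<close> containing \<open>q\<close>
  gives the last edge, and the offset in that block is the position to be realized one level
  lower.\<close>

lemma seg_exists:
  assumes "b \<in> A n" "q < length (wd 0 n b)"
  shows "\<exists>x. seg n x \<and> fst (x n) = b \<and> pos x 0 n = q"
  using assms
proof (induction n arbitrary: b q)
  case 0
  then show ?case
    by (intro exI[of _ "\<lambda>_. (b, 0)"]) (auto simp: seg_0_iff)
next
  case (Suc n)
  then have "q < length (morph_comp \<sigma> 0 n (\<sigma> n b))"
    by (simp add: morph_comp_letter_Suc)
  from morph_comp_locate[OF this] obtain j r where j: "j < length (\<sigma> n b)"
    and r: "r < length (wd 0 n (\<sigma> n b ! j))"
    and q: "q = length (morph_comp \<sigma> 0 n (take j (\<sigma> n b))) + r"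
    by blast
  have "\<sigma> n b ! j \<in> A n"
    using j morph_letters[of b n] Suc.prems nth_mem by blast
  then obtain x where x: "seg n x" "fst (x n) = \<sigma> n b ! j" "pos x 0 n = r"
    using Suc.IH r by blast
  define y where "y = x(Suc n := (b, j))"
  have y: "y (Suc n) = (b, j)" "\<And>i. i \<le> n \<Longrightarrow> y i = x i"
    by (auto simp: y_def)
  have "seg n y" "pos y 0 n = r"
    using x seg_cong[of n x y] pos_cong[of n x y 0] y by auto
  then show ?case
    using x y j q Suc.prems by (intro exI[of _ y]) (simp add: seg_Suc_iff pos_Suc pre_def)
qed

text \<open>Different labels on the last edge put the position into different blocks. With
  \<open>seg_exists\<close>, segments ending at \<open>b\<close> thus correspond, up to level
  \<open>n\<close>, to the positions in \<open>wd 0 n b\<close>.\<close>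

lemma seg_unique:
  assumes "seg n x" "seg n y" "fst (x n) = fst (y n)" "pos x 0 n = pos y 0 n" "i \<le> n"
  shows "x i = y i"
  using assms
proof (induction n arbitrary: i)
  case 0
  then show ?case
    by (simp add: seg_0_iff prod_eq_iff)
next
  case (Suc n)
  have *: False if "seg (Suc n) x" "seg (Suc n) y" "fst (x (Suc n)) = fst (y (Suc n))"
    "pos x 0 (Suc n) = pos y 0 (Suc n)" "snd (x (Suc n)) < snd (y (Suc n))" for x y
  proof -
    have "pos x 0 n < length (wd 0 n (\<sigma> n (fst (x (Suc n))) ! snd (x (Suc n))))"
      using length_wd[of 0 n x] that(1) by (simp add: seg_Suc_iff)
    moreover have "snd (y (Suc n)) \<le> length (\<sigma> n (fst (x (Suc n))))"
      using that(2,3) by (simp add: seg_Suc_iff)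
    ultimately show False
      using that(3-5) length_morph_comp_take_less[OF that(5), of "\<sigma> n (fst (x (Suc n)))" \<sigma> 0 n]
      by (simp add: pos_Suc pre_def)
  qed
  have "snd (x (Suc n)) = snd (y (Suc n))"
    using *[of x y] *[of y x] Suc.prems by (metis linorder_neqE_nat)
  then have eq: "x (Suc n) = y (Suc n)"
    using Suc.prems by (simp add: prod_eq_iff)
  then have "fst (x n) = fst (y n)" "pos x 0 n = pos y 0 n"
    using Suc.prems by (auto simp: seg_Suc_iff pos_Suc pre_def)
  then show ?case
    using Suc.IH[of i] Suc.prems eq by (cases "i = Suc n") (auto simp: seg_Suc_iff)
qed

lemma splice_path:
  assumes "seg n x" "y \<in> bv_paths A \<sigma>" "fst (x n) = fst (y n)"
  shows "(\<lambda>i. if i \<le> n then x i else y i) \<in> bv_paths A \<sigma>"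
proof -
  have "bv_range (x n) = bv_range (y n)"
    using assms(3) by (simp add: bv_range_def)
  then show ?thesis
    using assms(1,2) unfolding bv_paths_def seg_def
    by (auto simp: Suc_le_eq)
qed

lemma morph_comp_eq_Nil_iff:
  assumes "m \<le> n" "set w \<subseteq> A n"
  shows "morph_comp \<sigma> m n w = [] \<longleftrightarrow> w = []"
  using length_morph_comp_ge[OF assms] by auto

lemma pos_eq_0D:
  assumes "seg n x" "pos x 0 n = 0" "i < n"
  shows "pre x i = []"
proof -
  have "morph_comp \<sigma> 0 i (pre x i) = []"
    using assms(2,3) by (auto simp: pos_def)
  moreover have "set (pre x i) \<subseteq> A i"
    using pre_letters[of i x] seg_mono[OF assms(1), of "Suc i"] assms(3) by simp
  ultimately show ?thesis
    using morph_comp_eq_Nil_iff by blast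
qed

section \<open>Extremal edges in terms of prefixes and suffixes\<close>

lemma bv_max_edge_0: "bv_max_edge A \<sigma> 0 (x 0)" and bv_min_edge_0: "seg n x \<Longrightarrow> bv_min_edge A \<sigma> 0 (x 0)"
  using seg_mono[of n x 0] by (auto simp: bv_max_edge_def bv_min_edge_def seg_0_iff)

lemma bv_max_edge_iff:
  assumes "seg (Suc n) x"
  shows "bv_max_edge A \<sigma> (Suc n) (x (Suc n)) \<longleftrightarrow> post x n = []"
proof -
  have x: "fst (x (Suc n)) \<in> A (Suc n)" "snd (x (Suc n)) < length (\<sigma> n (fst (x (Suc n))))"
    using assms by (auto simp: seg_Suc_iff)
  then have "bv_max_edge A \<sigma> (Suc n) (x (Suc n)) \<longleftrightarrow>
      (\<forall>j<length (\<sigma> n (fst (x (Suc n)))). j \<le> snd (x (Suc n)))"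
    by (auto simp: bv_max_edge_def bv_range_def)
  also have "\<dots> \<longleftrightarrow> length (\<sigma> n (fst (x (Suc n)))) \<le> Suc (snd (x (Suc n)))"
    by (auto simp: not_less_eq_eq[symmetric] not_less)
  finally show ?thesis
    by (simp add: post_def)
qed

lemma bv_min_edge_iff:
  assumes "seg (Suc n) x"
  shows "bv_min_edge A \<sigma> (Suc n) (x (Suc n)) \<longleftrightarrow> pre x n = []"
proof -
  have x: "fst (x (Suc n)) \<in> A (Suc n)" "snd (x (Suc n)) < length (\<sigma> n (fst (x (Suc n))))"
    using assms by (auto simp: seg_Suc_iff)
  then have "bv_min_edge A \<sigma> (Suc n) (x (Suc n)) \<longleftrightarrow>
      (\<forall>j<length (\<sigma> n (fst (x (Suc n)))). snd (x (Suc n)) \<le> j)"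
    by (auto simp: bv_min_edge_def bv_range_def)
  also have "\<dots> \<longleftrightarrow> snd (x (Suc n)) = 0"
    using x(2) by force
  finally show ?thesis
    using x(2) by (auto simp: pre_def)
qed

lemma bv_succ_edge_iff:
  assumes "seg (Suc n) x"
  shows "bv_succ_edge A \<sigma> (Suc n) (x (Suc n)) f \<longleftrightarrow>
    f = (fst (x (Suc n)), Suc (snd (x (Suc n)))) \<and> post x n \<noteq> []"
proof -
  obtain a j where a: "x (Suc n) = (a, j)"
    by (cases "x (Suc n)")
  obtain b k where f: "f = (b, k)"
    by (cases f)
  have "a \<in> A (Suc n)" "j < length (\<sigma> n a)"
    using assms a by (auto simp: seg_Suc_iff)
  then have "bv_succ_edge A \<sigma> (Suc n) (a, j) (b, k) \<longleftrightarrow>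
      b = a \<and> k < length (\<sigma> n a) \<and> j < k \<and> (\<forall>i<length (\<sigma> n a). j < i \<longrightarrow> k \<le> i)"
    by (auto simp: bv_succ_edge_def bv_range_def)
  also have "\<dots> \<longleftrightarrow> b = a \<and> k = Suc j \<and> Suc j < length (\<sigma> n a)"
    by (auto simp: not_less Suc_le_eq intro: le_antisym)
  finally show ?thesis
    by (auto simp: a f post_def not_less_eq_eq)
qed

subsection \<open>The bi-infinite word of a path\<close>

text \<open>These paths are neither eventually minimal nor eventually maximal, so their windows grow
  without bound on both sides of the origin. Their complement is the exceptional set in the path
  space.\<close>

definition good :: "(nat \<Rightarrow> 'a edge) set" where
  "good = {x \<in> bv_paths A \<sigma>. (\<forall>n. \<exists>i\<ge>n. pre x i \<noteq> []) \<and> (\<forall>n. \<exists>i\<ge>n. post x i \<noteq> [])}"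

lemma good_path: "x \<in> good \<Longrightarrow> x \<in> bv_paths A \<sigma>"
  by (simp add: good_def)

lemma good_seg: "x \<in> good \<Longrightarrow> seg n x"
  by (simp add: good_def bv_paths_iff_seg)

lemma good_not_extremal: "good \<inter> (bv_max_paths A \<sigma> \<union> bv_min_paths A \<sigma>) = {}"
proof -
  have "x \<notin> bv_max_paths A \<sigma>" "x \<notin> bv_min_paths A \<sigma>" if x: "x \<in> good" for x
  proof -
    obtain i j where "post x i \<noteq> []" "pre x j \<noteq> []"
      using x unfolding good_def by blast
    then have "\<not> bv_max_edge A \<sigma> (Suc i) (x (Suc i))" "\<not> bv_min_edge A \<sigma> (Suc j) (x (Suc j))"
      using bv_max_edge_iff bv_min_edge_iff good_seg[OF x] by auto
    then show "x \<notin> bv_max_paths A \<sigma>" "x \<notin> bv_min_paths A \<sigma>"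
      by (auto simp: bv_max_paths_def bv_min_paths_def)
  qed
  then show ?thesis
    by blast
qed

lemma good_tail:
  assumes "x \<in> good" "y \<in> bv_paths A \<sigma>" "\<And>i. i > n \<Longrightarrow> y i = x i"
  shows "y \<in> good"
proof -
  have "pre y i = pre x i" "post y i = post x i" if "i \<ge> n" for i
    using assms(3)[of "Suc i"] that by (auto simp: pre_def post_def)
  moreover have "\<exists>i\<ge>k. i \<ge> n \<and> pre x i \<noteq> []" "\<exists>i\<ge>k. i \<ge> n \<and> post x i \<noteq> []" for k
    using assms(1) by (auto simp: good_def dest!: spec[of _ "max k n"])
  ultimately show ?thesis
    using assms(2) unfolding good_def by simp metis
qed

lemma good_pos_unbounded:
  assumes "x \<in> good"
  shows "\<exists>n\<ge>m. pos x m n \<ge> k" and "\<exists>n\<ge>m. rpos x m n \<ge> k"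
proof -
  show "\<exists>n\<ge>m. pos x m n \<ge> k"
  proof (induction k)
    case (Suc k)
    then obtain n where n: "n \<ge> m" "pos x m n \<ge> k" by blast
    obtain i where i: "i \<ge> n" "pre x i \<noteq> []"
      using assms by (auto simp: good_def)
    have "morph_comp \<sigma> m i (pre x i) \<noteq> []"
      using morph_comp_eq_Nil_iff[of m i "pre x i"] pre_letters[OF good_seg[OF assms]] n i by auto
    then have "pos x m (Suc i) \<ge> Suc k"
      using pos_mono[of n i x m] n i by (simp add: pos_Suc Suc_le_eq flip: length_greater_0_conv)
    then show ?case
      using n i by (intro exI[of _ "Suc i"]) auto
  qed auto
  show "\<exists>n\<ge>m. rpos x m n \<ge> k"
  proof (induction k)
    case (Suc k)
    then obtain n where n: "n \<ge> m" "rpos x m n \<ge> k" by blast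
    obtain i where i: "i \<ge> n" "post x i \<noteq> []"
      using assms by (auto simp: good_def)
    have "morph_comp \<sigma> m i (post x i) \<noteq> []"
      using morph_comp_eq_Nil_iff[of m i "post x i"] post_letters[OF good_seg[OF assms]] n i by auto
    then have "rpos x m (Suc i) \<ge> Suc k"
      using rpos_mono[of n i x m] n i by (simp add: rpos_Suc Suc_le_eq flip: length_greater_0_conv)
    then show ?case
      using n i by (intro exI[of _ "Suc i"]) auto
  qed auto
qed

lemma goodI_unbounded:
  assumes "x \<in> bv_paths A \<sigma>"
    and "\<And>k. \<exists>n. pos x 0 n \<ge> k" and "\<And>k. \<exists>n. rpos x 0 n \<ge> k"
  shows "x \<in> good"
proof -
  have "\<exists>i\<ge>n. pre x i \<noteq> []" for n
  proof (rule ccontr)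
    assume "\<not> ?thesis"
    then have "pos x 0 k \<le> pos x 0 n" for k
    proof (cases "k \<le> n")
      case False
      then have "n \<le> k" by simp
      then show ?thesis
        using \<open>\<not> (\<exists>i\<ge>n. pre x i \<noteq> [])\<close> by (induction k rule: dec_induct) (auto simp: pos_Suc)
    qed (rule pos_mono)
    then show False
      using assms(2)[of "Suc (pos x 0 n)"] by (meson not_less_eq_eq order_trans)
  qed
  moreover have "\<exists>i\<ge>n. post x i \<noteq> []" for n
  proof (rule ccontr)
    assume "\<not> ?thesis"
    then have "rpos x 0 k \<le> rpos x 0 n" for k
    proof (cases "k \<le> n")
      case False
      then have "n \<le> k" by simp
      then show ?thesis
        using \<open>\<not> (\<exists>i\<ge>n. post x i \<noteq> [])\<close> by (induction k rule: dec_induct) (auto simp: rpos_Suc)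
    qed (rule rpos_mono)
    then show False
      using assms(3)[of "Suc (rpos x 0 n)"] by (meson not_less_eq_eq order_trans)
  qed
  ultimately show ?thesis
    using assms(1) by (simp add: good_def)
qed

lemma good_window:
  assumes "x \<in> good"
  obtains n where "n \<ge> m" "n \<ge> N" "- int (pos x m n) \<le> s" "t \<le> int (rpos x m n)"
proof -
  obtain n1 n2 where "n1 \<ge> m" "pos x m n1 \<ge> nat (- s)" "n2 \<ge> m" "rpos x m n2 \<ge> nat t"
    using good_pos_unbounded[OF assms] by meson
  moreover define n where "n = max N (max n1 n2)"
  moreover have "n \<ge> n1" "n \<ge> n2" "n \<ge> N"
    by (auto simp: n_def)
  ultimately show ?thesis
    using pos_mono[of n1 n x m] rpos_mono[of n2 n x m] by (intro that[of n]) linarith+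
qed

text \<open>The windows \<open>wd m n (fst (x n))\<close> are placed with index
  \<open>pos x m n\<close> at the origin. The least level merely fixes a choice: by nesting, every
  window containing \<open>t\<close> gives the same letter.\<close>

definition path_word :: "nat \<Rightarrow> (nat \<Rightarrow> 'a edge) \<Rightarrow> int \<Rightarrow> 'a" where
  "path_word m x t =
     (let n = (LEAST n. m \<le> n \<and> - int (pos x m n) \<le> t \<and> t \<le> int (rpos x m n))
      in wd m n (fst (x n)) ! nat (t + int (pos x m n)))"

lemma path_word_eq:
  assumes "x \<in> bv_paths A \<sigma>" "m \<le> n" "- int (pos x m n) \<le> t" "t \<le> int (rpos x m n)"
  shows "path_word m x t = wd m n (fst (x n)) ! nat (t + int (pos x m n))"
proof -
  define P where "P n \<longleftrightarrow> m \<le> n \<and> - int (pos x m n) \<le> t \<and> t \<le> int (rpos x m n)" for n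
  define k where "k = (LEAST n. P n)"
  have "P n" using assms by (simp add: P_def)
  then have k: "P k" "k \<le> n"
    unfolding k_def by (auto intro: LeastI Least_le)
  have s: "seg n x" "seg k x" using assms(1) by (auto simp: bv_paths_iff_seg)
  have "nat (t + int (pos x m k)) < length (wd m k (fst (x k)))"
    using k(1) length_wd[of m k x] s by (auto simp: P_def)
  from nth_wd_nested[OF _ k(2) s(1) this] k(1)
  have "wd m k (fst (x k)) ! nat (t + int (pos x m k)) =
      wd m n (fst (x n)) ! (pos x m n - pos x m k + nat (t + int (pos x m k)))"
    by (simp add: P_def)
  also have "pos x m n - pos x m k + nat (t + int (pos x m k)) = nat (t + int (pos x m n))"
    using pos_mono[OF k(2), of x m] k(1) by (auto simp: P_def)
  finally show ?thesis
    by (simp add: path_word_def Let_def flip: P_def k_def)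
qed

lemma path_word_0:
  assumes "x \<in> bv_paths A \<sigma>"
  shows "path_word m x 0 = fst (x m)"
  using path_word_eq[OF assms order_refl, of m 0] by simp

text \<open>A single window is compared, so that the relation makes sense for a path segment, before
  any infinite path for \<open>y\<close> is known.\<close>

definition covers :: "(nat \<Rightarrow> 'a edge) \<Rightarrow> nat \<Rightarrow> (int \<Rightarrow> 'a) \<Rightarrow> bool" where
  "covers x n y \<longleftrightarrow>
     (\<forall>t<length (wd 0 n (fst (x n))). y (int t - int (pos x 0 n)) = wd 0 n (fst (x n)) ! t)"

lemma path_word_unique:
  assumes "x \<in> good" "\<And>n. covers x n y"
  shows "path_word 0 x = y"
proof
  fix t
  obtain n where n: "- int (pos x 0 n) \<le> t" "t \<le> int (rpos x 0 n)"
    using good_window[OF assms(1), of 0 0 t t] by blast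
  have "nat (t + int (pos x 0 n)) < length (wd 0 n (fst (x n)))"
    using n length_wd[of 0 n x] good_seg[OF assms(1), of n] by simp
  then have "y (int (nat (t + int (pos x 0 n))) - int (pos x 0 n)) =
      wd 0 n (fst (x n)) ! nat (t + int (pos x 0 n))"
    using assms(2)[of n] unfolding covers_def by blast
  then show "path_word 0 x t = y t"
    using n path_word_eq[OF good_path[OF assms(1)] _ n] by simp
qed

lemma path_word_in_shift:
  assumes "x \<in> good"
  shows "path_word m x \<in> sadic_shift A \<sigma> m"
proof -
  have letter: "path_word m x t \<in> A m" for t
  proof -
    obtain n where n: "n \<ge> m" "- int (pos x m n) \<le> t" "t \<le> int (rpos x m n)"
      using good_window[OF assms, of m 0 t t] by blast
    have "nat (t + int (pos x m n)) < length (wd m n (fst (x n)))"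
      using n length_wd[of m n x] good_seg[OF assms, of n] by simp
    moreover have "set (wd m n (fst (x n))) \<subseteq> A m"
      using n seg_letter[OF good_seg[OF assms, of n]] by (intro morph_comp_letters) auto
    ultimately show ?thesis
      using path_word_eq[OF good_path[OF assms] n] nth_mem by fastforce
  qed
  have "map (\<lambda>j. path_word m x (i + int j)) [0..<l] \<in> language A \<sigma> m" for i l
  proof -
    \<comment> \<open>The bound \<open>Suc m\<close> is required because \<open>language\<close>
      only uses words from levels strictly above \<open>m\<close>.\<close>
    obtain n where n: "n \<ge> m" "n \<ge> Suc m" "- int (pos x m n) \<le> i" "i + int l \<le> int (rpos x m n)"
      using good_window[OF assms, of m "Suc m" i "i + int l"] by blast
    let ?q = "nat (i + int (pos x m n))"
    have len: "?q + l < length (wd m n (fst (x n)))"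
      using n length_wd[of m n x] good_seg[OF assms, of n] by simp
    have "path_word m x (i + int j) = wd m n (fst (x n)) ! (?q + j)" if "j < l" for j
    proof -
      have "nat (i + int j + int (pos x m n)) = ?q + j"
        using n by simp
      then show ?thesis
        using path_word_eq[OF good_path[OF assms] n(1), of "i + int j"] n that by simp
    qed
    then have "map (\<lambda>j. path_word m x (i + int j)) [0..<l] = take l (drop ?q (wd m n (fst (x n))))"
      using len by (intro nth_equalityI) auto
    moreover have "sublist (take l (drop ?q (wd m n (fst (x n))))) (wd m n (fst (x n)))"
      by (meson sublist_drop sublist_order.order_trans sublist_take)
    moreover have "fst (x n) \<in> A n"
      using seg_letter[OF good_seg[OF assms, of n]] by simp
    ultimately have "\<exists>N>m. \<exists>a\<in>A N. sublist (map (\<lambda>j. path_word m x (i + int j)) [0..<l]) (wd m N a)"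
      using n(2) by (intro exI[of _ n] conjI bexI[of _ "fst (x n)"]) auto
    then show ?thesis
      using letter by (auto simp: language_def)
  qed
  then show ?thesis
    using letter by (simp add: sadic_shift_def)
qed

subsection \<open>The Vershik map\<close>

text \<open>A maximal initial segment marks the last letter of its block, a minimal one the first
  letter of the next block. From the changed edge upwards the vertices agree, so the position is
  exactly one larger.\<close>

lemma vershik_successor_pos:
  assumes "x \<in> bv_paths A \<sigma>" "vershik_successor A \<sigma> x y"
  obtains n where "\<And>k. k \<ge> n \<Longrightarrow> fst (y k) = fst (x k)" "\<And>k. k \<ge> n \<Longrightarrow> pos y 0 k = Suc (pos x 0 k)"
    "\<And>i. i > n \<Longrightarrow> y i = x i"
proof -
  obtain n' where n': "\<not> bv_max_edge A \<sigma> n' (x n')" "\<forall>i<n'. bv_max_edge A \<sigma> i (x i)"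
      "\<forall>i>n'. y i = x i" "bv_succ_edge A \<sigma> n' (x n') (y n')" "\<forall>i<n'. bv_min_edge A \<sigma> i (y i)"
      and y: "y \<in> bv_paths A \<sigma>"
    using assms(2) by (auto simp: vershik_successor_def)
  obtain n where n: "n' = Suc n"
    using n'(1) bv_max_edge_0 by (cases n') auto
  have sx: "seg k x" and sy: "seg k y" for k
    using assms(1) y by (auto simp: bv_paths_iff_seg)
  have yn: "y (Suc n) = (fst (x (Suc n)), Suc (snd (x (Suc n))))"
    using n' n bv_succ_edge_iff[OF sx] by auto
  have "post x i = []" if "i < n" for i
    using n'(2) n that bv_max_edge_iff[OF sx] by auto
  then have r0: "rpos x 0 n = 0"
    by (simp add: rpos_def)
  have "pre y i = []" if "i < n" for i
    using n'(5) n that bv_min_edge_iff[OF sy] by auto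
  then have p0: "pos y 0 n = 0"
    by (simp add: pos_def)
  have x: "snd (x (Suc n)) < length (\<sigma> n (fst (x (Suc n))))"
    "fst (x n) = \<sigma> n (fst (x (Suc n))) ! snd (x (Suc n))"
    using sx[of "Suc n"] by (auto simp: seg_Suc_iff)
  have "pos y 0 (Suc n) = length (morph_comp \<sigma> 0 n (pre x n @ [fst (x n)]))"
    using p0 yn x by (simp add: pos_Suc pre_def take_Suc_conv_app_nth del: morph_comp_append)
  \<comment> \<open>With \<open>rpos x 0 n = 0\<close>, the block of \<open>fst (x n)\<close> has
    \<open>pos x 0 n + 1\<close> letters; this 1 is the step of the Vershik map.\<close>
  also have "\<dots> = Suc (pos x 0 (Suc n))"
    using r0 length_wd[OF _ sx, of 0 n] by (simp add: pos_Suc)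
  finally have *: "pos y 0 (Suc n) = Suc (pos x 0 (Suc n))" .
  have "pos y 0 k = Suc (pos x 0 k)" if "k \<ge> Suc n" for k
    using that
  proof (induction k rule: dec_induct)
    case (step k)
    then have "pre y k = pre x k"
      using n'(3) n by (simp add: pre_def)
    with step show ?case
      by (simp add: pos_Suc)
  qed (fact *)
  moreover have "fst (y k) = fst (x k)" if "k \<ge> Suc n" for k
    using that yn n'(3) n by (cases "k = Suc n") auto
  ultimately show ?thesis
    using n'(3) n by (intro that[of "Suc n"]) auto
qed

lemma paths_eqI:
  assumes "x \<in> bv_paths A \<sigma>" "y \<in> bv_paths A \<sigma>"
    and "fst (x n) = fst (y n)" "pos x 0 n = pos y 0 n" "\<And>i. i > n \<Longrightarrow> x i = y i"
  shows "x = y"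
proof
  fix i
  show "x i = y i"
    using assms seg_unique[of n x y i] by (cases "i \<le> n") (auto simp: bv_paths_iff_seg)
qed

lemma vershik_successor_unique:
  assumes "x \<in> bv_paths A \<sigma>" "vershik_successor A \<sigma> x y" "vershik_successor A \<sigma> x z"
  shows "y = z"
proof -
  obtain n1 where n1: "\<And>k. k \<ge> n1 \<Longrightarrow> fst (y k) = fst (x k)"
    "\<And>k. k \<ge> n1 \<Longrightarrow> pos y 0 k = Suc (pos x 0 k)" "\<And>i. i > n1 \<Longrightarrow> y i = x i"
    by (rule vershik_successor_pos[OF assms(1,2)]) blast
  obtain n2 where n2: "\<And>k. k \<ge> n2 \<Longrightarrow> fst (z k) = fst (x k)"
    "\<And>k. k \<ge> n2 \<Longrightarrow> pos z 0 k = Suc (pos x 0 k)" "\<And>i. i > n2 \<Longrightarrow> z i = x i"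
    by (rule vershik_successor_pos[OF assms(1,3)]) blast
  show ?thesis
    using assms(2,3) n1 n2
    by (intro paths_eqI[of y z "max n1 n2"]) (auto simp: vershik_successor_def)
qed

lemma vershik_successor_exists:
  assumes "x \<in> bv_paths A \<sigma>" "\<exists>i. post x i \<noteq> []"
  shows "\<exists>y. vershik_successor A \<sigma> x y"
proof -
  define n where "n = (LEAST i. post x i \<noteq> [])"
  have n: "post x n \<noteq> []"
    unfolding n_def by (rule LeastI_ex[OF assms(2)])
  have max: "post x i = []" if "i < n" for i
    using not_less_Least[of i "\<lambda>i. post x i \<noteq> []"] that by (simp add: n_def)
  have sx: "seg k x" for k
    using assms(1) by (auto simp: bv_paths_iff_seg)
  obtain a j where a: "x (Suc n) = (a, j)"
    by (cases "x (Suc n)")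
  have aA: "a \<in> A (Suc n)"
    using sx[of "Suc n"] a by (simp add: seg_Suc_iff)
  have j: "Suc j < length (\<sigma> n a)"
    using n a by (simp add: post_def)
  then have b: "\<sigma> n a ! Suc j \<in> A n"
    using morph_letters[OF aA] nth_mem by blast
  moreover have "0 < length (wd 0 n (\<sigma> n a ! Suc j))"
    using length_morph_comp_ge[of 0 n "[\<sigma> n a ! Suc j]"] b by (simp add: morph_comp_eq_Nil_iff)
  \<comment> \<open>Position 0 makes \<open>z\<close> the minimal path to the source of the
    successor edge.\<close>
  ultimately obtain z where z: "seg n z" "fst (z n) = \<sigma> n a ! Suc j" "pos z 0 n = 0"
    using seg_exists[of "\<sigma> n a ! Suc j" n 0] by blast
  define z' where "z' = z(Suc n := (a, Suc j))"
  have z': "z' (Suc n) = (a, Suc j)" "\<And>i. i \<le> n \<Longrightarrow> z' i = z i"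
    by (auto simp: z'_def)
  define y where "y = (\<lambda>i. if i \<le> Suc n then z' i else x i)"
  have sz: "seg (Suc n) z'"
    using z z' j aA seg_cong[of n z z'] by (simp add: seg_Suc_iff)
  then have y: "y \<in> bv_paths A \<sigma>"
    unfolding y_def using assms(1) a z' by (intro splice_path) simp_all
  then have sy: "seg k y" for k
    by (simp add: bv_paths_iff_seg)
  have "pre y i = []" if "i < n" for i
    using that pos_eq_0D[OF z(1,3) that] by (simp add: pre_def y_def z')
  then have "bv_min_edge A \<sigma> i (y i)" if "i < Suc n" for i
    using bv_min_edge_0[OF sy] bv_min_edge_iff[OF sy] that by (cases i) auto
  moreover have "bv_max_edge A \<sigma> i (x i)" if "i < Suc n" for i
    using bv_max_edge_0[of x] bv_max_edge_iff[OF sx] that max by (cases i) auto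
  moreover have "bv_succ_edge A \<sigma> (Suc n) (x (Suc n)) (y (Suc n))"
    unfolding bv_succ_edge_iff[OF sx] using n a by (simp add: y_def z')
  moreover have "\<not> bv_max_edge A \<sigma> (Suc n) (x (Suc n))"
    using n bv_max_edge_iff[OF sx] by simp
  moreover have "\<forall>i>Suc n. y i = x i"
    by (simp add: y_def)
  ultimately show ?thesis
    using y unfolding vershik_successor_def by blast
qed

lemma vershik_map_successor:
  assumes "x \<in> bv_paths A \<sigma>" "\<exists>i. post x i \<noteq> []"
  shows "vershik_successor A \<sigma> x (vershik_map A \<sigma> x)"
  unfolding vershik_map_def
proof -
  obtain y where y: "vershik_successor A \<sigma> x y"
    using vershik_successor_exists[OF assms] by blast
  then show "vershik_successor A \<sigma> x (THE y. vershik_successor A \<sigma> x y)"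
    using theI[of "vershik_successor A \<sigma> x" y] vershik_successor_unique[OF assms(1) _ y] by blast
qed

lemma vershik_map_pos:
  assumes "x \<in> good"
  obtains n where "\<And>k. k \<ge> n \<Longrightarrow> fst (vershik_map A \<sigma> x k) = fst (x k)"
    "\<And>k. k \<ge> n \<Longrightarrow> pos (vershik_map A \<sigma> x) 0 k = Suc (pos x 0 k)"
    "\<And>i. i > n \<Longrightarrow> vershik_map A \<sigma> x i = x i"
proof -
  have "x \<in> bv_paths A \<sigma>" "\<exists>i. post x i \<noteq> []"
    using assms by (auto simp: good_def)
  then show ?thesis
    using vershik_successor_pos[OF _ vershik_map_successor, of x] that by blast
qed

lemma vershik_map_good:
  assumes "x \<in> good"
  shows "vershik_map A \<sigma> x \<in> good"
proof (rule vershik_map_pos[OF assms])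
  fix n
  assume "\<And>i. i > n \<Longrightarrow> vershik_map A \<sigma> x i = x i"
  moreover have "vershik_successor A \<sigma> x (vershik_map A \<sigma> x)"
    using assms vershik_map_successor[of x] by (force simp: good_def)
  ultimately show ?thesis
    by (intro good_tail[OF assms]) (auto simp: vershik_successor_def)
qed

lemma path_word_vershik_map:
  assumes "x \<in> good"
  shows "path_word 0 (vershik_map A \<sigma> x) = left_shift (path_word 0 x)"
proof (rule vershik_map_pos[OF assms], rule ext)
  fix n t
  let ?y = "vershik_map A \<sigma> x"
  assume n: "\<And>k. k \<ge> n \<Longrightarrow> fst (?y k) = fst (x k)"
    "\<And>k. k \<ge> n \<Longrightarrow> pos ?y 0 k = Suc (pos x 0 k)"
  have y: "?y \<in> good"
    by (rule vershik_map_good[OF assms])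
  \<comment> \<open>Room for \<open>t + 1\<close> is required: the image path has one letter fewer
    to the right of the origin.\<close>
  obtain k where k: "k \<ge> n" "- int (pos x 0 k) \<le> t" "t + 1 \<le> int (rpos x 0 k)"
    using good_window[OF assms, of 0 n t "t + 1"] by blast
  have "pos ?y 0 k + rpos ?y 0 k = pos x 0 k + rpos x 0 k"
    using length_wd[OF _ good_seg[OF y], of 0 k] length_wd[OF _ good_seg[OF assms], of 0 k] n(1)[OF k(1)]
    by simp
  then have "path_word 0 ?y t = wd 0 k (fst (?y k)) ! nat (t + int (pos ?y 0 k))"
    using k n(2)[OF k(1)] by (intro path_word_eq[OF good_path[OF y]]) auto
  also have "\<dots> = wd 0 k (fst (x k)) ! nat ((t + 1) + int (pos x 0 k))"
    using n[OF k(1)] by (simp add: algebra_simps)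
  also have "\<dots> = path_word 0 x (t + 1)"
    using k by (intro path_word_eq[OF good_path[OF assms], symmetric]) auto
  finally show "path_word 0 ?y t = left_shift (path_word 0 x) t"
    by (simp add: shift_pow_def)
qed

text \<open>Vertex and position at a high level, together with the unchanged tail, recover
  \<open>x\<close> from its image. For surjectivity the origin is moved one letter to the left in a
  window that has a letter there.\<close>

lemma bij_vershik_map: "bij_betw (vershik_map A \<sigma>) good good"
proof (rule bij_betw_imageI)
  show "inj_on (vershik_map A \<sigma>) good"
  proof (rule inj_onI)
    fix x y assume x: "x \<in> good" and y: "y \<in> good" and eq: "vershik_map A \<sigma> x = vershik_map A \<sigma> y"
    obtain n1 where n1: "\<And>k. k \<ge> n1 \<Longrightarrow> fst (vershik_map A \<sigma> x k) = fst (x k)"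
      "\<And>k. k \<ge> n1 \<Longrightarrow> pos (vershik_map A \<sigma> x) 0 k = Suc (pos x 0 k)"
      "\<And>i. i > n1 \<Longrightarrow> vershik_map A \<sigma> x i = x i"
      by (rule vershik_map_pos[OF x]) blast
    obtain n2 where n2: "\<And>k. k \<ge> n2 \<Longrightarrow> fst (vershik_map A \<sigma> y k) = fst (y k)"
      "\<And>k. k \<ge> n2 \<Longrightarrow> pos (vershik_map A \<sigma> y) 0 k = Suc (pos y 0 k)"
      "\<And>i. i > n2 \<Longrightarrow> vershik_map A \<sigma> y i = y i"
      by (rule vershik_map_pos[OF y]) blast
    show "x = y"
    proof (rule paths_eqI[of x y "max n1 n2"])
      show "fst (x (max n1 n2)) = fst (y (max n1 n2))"
        using n1(1)[of "max n1 n2"] n2(1)[of "max n1 n2"] eq by simp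
      show "pos x 0 (max n1 n2) = pos y 0 (max n1 n2)"
        using n1(2)[of "max n1 n2"] n2(2)[of "max n1 n2"] eq by simp
      show "x i = y i" if "i > max n1 n2" for i
        using n1(3)[of i] n2(3)[of i] eq that by simp
    qed (use x y good_path in auto)
  qed
  show "vershik_map A \<sigma> ` good = good"
  proof
    show "good \<subseteq> vershik_map A \<sigma> ` good"
    proof
      fix y assume y: "y \<in> good"
      obtain N where N: "pos y 0 N \<ge> 1"
        using good_pos_unbounded(1)[OF y, of 0 1] by blast
      have "fst (y N) \<in> A N" "pos y 0 N - 1 < length (wd 0 N (fst (y N)))"
        using seg_letter[OF good_seg[OF y], of N N] length_wd[OF _ good_seg[OF y], of 0 N] by auto
      then obtain z where z: "seg N z" "fst (z N) = fst (y N)" "pos z 0 N = pos y 0 N - 1"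
        using seg_exists by blast
      define x where "x = (\<lambda>i. if i \<le> N then z i else y i)"
      have xp: "x \<in> bv_paths A \<sigma>"
        unfolding x_def using z good_path[OF y] by (intro splice_path) auto
      then have x: "x \<in> good"
        by (rule good_tail[OF y, of _ N]) (simp add: x_def)
      have posx: "Suc (pos x 0 k) = pos y 0 k" if "k \<ge> N" for k
        using that
      proof (induction k rule: dec_induct)
        case base
        show ?case
          using z N pos_cong[of N x z 0] by (simp add: x_def)
      next
        case (step k)
        then have "pre x k = pre y k"
          by (simp add: pre_def x_def)
        with step show ?case
          by (simp add: pos_Suc)
      qed
      have fstx: "fst (x k) = fst (y k)" if "k \<ge> N" for k
        using that z(2) by (cases "k = N") (auto simp: x_def)
      obtain n where n: "\<And>k. k \<ge> n \<Longrightarrow> fst (vershik_map A \<sigma> x k) = fst (x k)"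
        "\<And>k. k \<ge> n \<Longrightarrow> pos (vershik_map A \<sigma> x) 0 k = Suc (pos x 0 k)"
        "\<And>i. i > n \<Longrightarrow> vershik_map A \<sigma> x i = x i"
        by (rule vershik_map_pos[OF x]) blast
      have "vershik_map A \<sigma> x = y"
      proof (rule paths_eqI[of _ _ "max n N"])
        show "vershik_map A \<sigma> x i = y i" if "i > max n N" for i
          using n(3)[of i] that by (simp add: x_def)
      qed (use n[of "max n N"] posx[of "max n N"] fstx[of "max n N"]
              vershik_map_good[OF x] y good_path in auto)
      then show "y \<in> vershik_map A \<sigma> ` good"
        using x by blast
    qed
  qed (use vershik_map_good in blast)
qed

subsection \<open>Injectivity under recognizability\<close>

text \<open>The origin of the level \<open>m\<close> word lies in the image of the level
  \<open>Suc m\<close> letter at the origin, at the offset given by the label of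
  \<open>x (Suc m)\<close>. Both words are compared inside one window of level
  \<open>n\<close>.\<close>

lemma path_word_representation:
  assumes "x \<in> good"
  shows "path_word m x = shift_pow (int (snd (x (Suc m)))) (morph_biinf (\<sigma> m) (path_word (Suc m) x))"
proof
  fix t
  let ?j = "snd (x (Suc m))" and ?X = "path_word (Suc m) x"
  obtain n where n: "n \<ge> m" "n \<ge> Suc m" "- int (pos x m n) \<le> t" "t \<le> int (rpos x m n)"
    using good_window[OF assms, of m "Suc m" t t] by blast
  define w where "w = wd (Suc m) n (fst (x n))"
  define r where "r = pos x (Suc m) n"
  define P where "P = nat (t + int (pos x m n))"
  have sx: "seg k x" for k
    using good_seg[OF assms] .
  have r: "r < length w"
    using length_wd[OF n(2) sx] by (simp add: w_def r_def)
  have X: "?X (int d - int r) = w ! d" if "d < length w" for d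
    using that length_wd[OF n(2) sx] path_word_eq[OF good_path[OF assms] n(2), of "int d - int r"]
    by (simp add: w_def r_def)
  have comp: "morph_comp \<sigma> m (Suc m) = morph_word (\<sigma> m)"
    by (rule ext) (rule morph_comp_single)
  have "wd m n (fst (x n)) = morph_word (\<sigma> m) w"
    using morph_comp_compose[of m "Suc m" n \<sigma>] n(2) by (simp add: w_def comp)
  moreover have "path_word m x t = wd m n (fst (x n)) ! P" "P < length (wd m n (fst (x n)))"
    using path_word_eq[OF good_path[OF assms] n(1,3,4)] length_wd[OF n(1) sx] n(3,4)
    by (auto simp: P_def)
  ultimately have Pw: "path_word m x t = morph_word (\<sigma> m) w ! P" and P: "P < length (morph_word (\<sigma> m) w)"
    by simp_all
  have "pos x m (Suc m) = ?j"
    using sx[of "Suc m"] by (simp add: pos_Suc pre_def seg_Suc_iff)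
  then have "pos x m n = length (morph_word (\<sigma> m) (take r w)) + ?j"
    using pos_split[of m "Suc m" n x] n(2) sx by (simp add: comp w_def r_def)
  \<comment> \<open>Adding the label moves the reference point to the left end of the block
    containing the origin, which is the origin of \<open>morph_biinf\<close>.\<close>
  then have tP: "t + int ?j = int P - int (length (morph_word (\<sigma> m) (take r w)))"
    using n(3) by (simp add: P_def)
  obtain d e where d: "d < length w" and e: "e < length (\<sigma> m (w ! d))"
    and Pd: "P = length (morph_word (\<sigma> m) (take d w)) + e"
    using morph_comp_locate[of P \<sigma> m "Suc m" w] P by (auto simp: comp morph_word_def)
  have bs: "block_start (\<sigma> m) ?X (int d - int r) =
      int (length (morph_word (\<sigma> m) (take d w))) - int (length (morph_word (\<sigma> m) (take r w)))"
    using r d X by (intro block_start_window) auto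
  then have "morph_biinf (\<sigma> m) ?X (t + int ?j) =
      \<sigma> m (?X (int d - int r)) ! nat (t + int ?j - block_start (\<sigma> m) ?X (int d - int r))"
    using e X[OF d] by (intro morph_biinf_eq) (auto simp: block_start_Suc tP Pd)
  also have "\<dots> = \<sigma> m (w ! d) ! e"
    using bs X[OF d] by (simp add: tP Pd)
  also have "\<dots> = morph_word (\<sigma> m) w ! P"
  proof -
    have "morph_word (\<sigma> m) w = morph_word (\<sigma> m) (take d w) @ \<sigma> m (w ! d) @ morph_word (\<sigma> m) (drop (Suc d) w)"
      by (subst id_take_nth_drop[OF d]) (simp add: morph_word_def)
    then show ?thesis
      using e by (simp add: Pd nth_append)
  qed
  finally show "path_word m x t = shift_pow (int ?j) (morph_biinf (\<sigma> m) ?X) t"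
    by (simp add: shift_pow_def Pw)
qed

text \<open>\<open>path_word_representation\<close> is a centered representation in the next shift.
  Uniqueness therefore passes equality of words from level \<open>m\<close> to \<open>Suc m\<close>
  and yields equal labels; the letters at the origin give equal vertices.\<close>

lemma path_word_inj:
  assumes "recognizable A \<sigma>"
  shows "inj_on (path_word 0) good"
proof (rule inj_onI)
  fix x y assume x: "x \<in> good" and y: "y \<in> good" and eq: "path_word 0 x = path_word 0 y"
  let ?rep = "\<lambda>z m. (int (snd (z (Suc m))), path_word (Suc m) z)"
  have step: "?rep x m = ?rep y m" if "path_word m x = path_word m y" for m
  proof -
    have rep: "is_representation (\<sigma> m) (path_word m z) (?rep z m) \<and> is_centered (\<sigma> m) (?rep z m) \<and>
        snd (?rep z m) \<in> sadic_shift A \<sigma> (Suc m)" if z: "z \<in> good" for z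
      using path_word_representation[OF z, of m] path_word_in_shift[OF z, of "Suc m"]
        good_seg[OF z, of "Suc m"] path_word_0[OF good_path[OF z], of "Suc m"]
      by (simp add: is_representation_def is_centered_def seg_Suc_iff)
    have "\<forall>i. path_word m x i \<in> A m"
      using path_word_in_shift[OF x, of m] by (simp add: sadic_shift_def)
    then have "\<exists>\<^sub>\<le>\<^sub>1 p. is_representation (\<sigma> m) (path_word m x) p \<and> is_centered (\<sigma> m) p \<and>
        snd p \<in> sadic_shift A \<sigma> (Suc m)"
      using assms unfolding recognizable_def by blast
    moreover note rep[OF x]
    moreover have "is_representation (\<sigma> m) (path_word m x) (?rep y m) \<and> is_centered (\<sigma> m) (?rep y m) \<and>
        snd (?rep y m) \<in> sadic_shift A \<sigma> (Suc m)"
      using rep[OF y] that by simp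
    ultimately show ?thesis
      by (rule Uniq_D)
  qed
  have words: "path_word m x = path_word m y" for m
    by (induction m) (use eq step in auto)
  have "fst (x m) = fst (y m)" for m
    using words[of m] path_word_0 x y good_path by metis
  moreover have "snd (x m) = snd (y m)" for m
    using step[OF words] good_seg[OF x, of 0] good_seg[OF y, of 0]
    by (cases m) (auto simp: seg_0_iff)
  ultimately show "x = y"
    by (intro ext prod_eqI) auto
qed

lemma morph_growing:
  assumes "everywhere_growing A \<sigma>"
  shows "\<forall>\<^sub>F N in sequentially. \<forall>b\<in>A N. k \<le> length (wd 0 N b)"
proof -
  have "\<forall>\<^sub>F N in sequentially. k \<le> Min ((\<lambda>a. length (wd 0 N a)) ` A N)"
    using assms by (simp add: everywhere_growing_def filterlim_at_top)
  then show ?thesis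
    by eventually_elim (use finite_alphabet in \<open>auto intro: Min_le order_trans\<close>)
qed

subsection \<open>Cylinder sets\<close>

abbreviation segment_list :: "nat \<Rightarrow> (nat \<Rightarrow> 'a edge) \<Rightarrow> 'a edge list" where
  "segment_list n x \<equiv> map x [0..<Suc n]"

lemma bv_finite_path_segment: "seg n x \<Longrightarrow> bv_finite_path A \<sigma> (segment_list n x)"
  by (auto simp: seg_def bv_finite_path_def simp del: upt_Suc)

lemma segment_in_paths_to: "seg n x \<Longrightarrow> segment_list n x \<in> bv_paths_to A \<sigma> (Suc n) (Some (fst (x n)))"
  using bv_finite_path_segment by (auto simp: bv_paths_to_def bv_end_def bv_range_def)

lemma cylinder_segment:
  "z \<in> bv_cylinder A \<sigma> (segment_list n x) \<longleftrightarrow> z \<in> bv_paths A \<sigma> \<and> (\<forall>i\<le>n. z i = x i)"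
  by (auto simp: bv_cylinder_def less_Suc_eq_le simp del: upt_Suc)

lemma openin_cylinder: "seg n x \<Longrightarrow> openin (bv_topology A \<sigma>) (bv_cylinder A \<sigma> (segment_list n x))"
  unfolding bv_topology_def using bv_finite_path_segment by (intro topology_generated_by_Basis) blast

text \<open>Floor \<open>q\<close> of the Kakutani-Rokhlin tower over the level \<open>n\<close>
  letter \<open>b\<close>; for \<open>q\<close> below the height \<open>length (wd 0 n b)\<close> it
  is a single cylinder.\<close>

definition tower :: "nat \<Rightarrow> 'a \<Rightarrow> nat \<Rightarrow> (nat \<Rightarrow> 'a edge) set" where
  "tower n b q = {x \<in> bv_paths A \<sigma>. fst (x n) = b \<and> pos x 0 n = q}"

lemma tower_eq_cylinder:
  assumes "b \<in> A n" "q < length (wd 0 n b)"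
  obtains x where "seg n x" "fst (x n) = b" "tower n b q = bv_cylinder A \<sigma> (segment_list n x)"
proof -
  obtain x where x: "seg n x" "fst (x n) = b" "pos x 0 n = q"
    using seg_exists[OF assms] by blast
  have "z \<in> tower n b q \<longleftrightarrow> z \<in> bv_cylinder A \<sigma> (segment_list n x)" for z
    unfolding cylinder_segment tower_def
    using seg_unique[OF _ x(1), of z] x pos_cong[of n z x 0] by (auto simp: bv_paths_iff_seg)
  then show ?thesis
    using x that by blast
qed

subsection \<open>Almost every path is good\<close>

context
  fixes \<mu> :: "(nat \<Rightarrow> 'a edge) measure"
  assumes \<mu>: "\<mu> \<in> sys_inv (bratteli_vershik_system A \<sigma>)"
begin

lemma bv_prob_space: "prob_space \<mu>"
  and sets_bv: "sets \<mu> = sets (borel_of (bv_topology A \<sigma>))"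
  using \<mu> unfolding bratteli_vershik_system_def system.select_convs by blast+

lemma bv_cylinder_measure_eq:
  assumes "seg n x" "seg n y" "fst (x n) = fst (y n)"
  shows "emeasure \<mu> (bv_cylinder A \<sigma> (segment_list n x)) = emeasure \<mu> (bv_cylinder A \<sigma> (segment_list n y))"
proof -
  have "Some (fst (x n)) \<in> bv_vertices A (Suc n)"
    using seg_letter[OF assms(1)] by simp
  moreover have "segment_list n y \<in> bv_paths_to A \<sigma> (Suc n) (Some (fst (x n)))"
    using segment_in_paths_to[OF assms(2)] assms(3) by simp
  moreover have "\<forall>n. \<forall>v\<in>bv_vertices A n. \<forall>p\<in>bv_paths_to A \<sigma> n v. \<forall>q\<in>bv_paths_to A \<sigma> n v.
      emeasure \<mu> (bv_cylinder A \<sigma> p) = emeasure \<mu> (bv_cylinder A \<sigma> q)"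
    using \<mu> unfolding bratteli_vershik_system_def system.select_convs by blast
  ultimately show ?thesis
    using segment_in_paths_to[OF assms(1)] by blast
qed

lemma tower_sets: "b \<in> A n \<Longrightarrow> q < length (wd 0 n b) \<Longrightarrow> tower n b q \<in> sets \<mu>"
  by (erule (1) tower_eq_cylinder)
     (simp add: sets_bv sets_borel_of_openin openin_cylinder del: upt_Suc)

lemma tower_measure_eq:
  assumes "b \<in> A n" "q < length (wd 0 n b)" "r < length (wd 0 n b)"
  shows "measure \<mu> (tower n b q) = measure \<mu> (tower n b r)"
proof -
  obtain x y where "seg n x" "fst (x n) = b" "tower n b q = bv_cylinder A \<sigma> (segment_list n x)"
    "seg n y" "fst (y n) = b" "tower n b r = bv_cylinder A \<sigma> (segment_list n y)"
    using tower_eq_cylinder[OF assms(1,2)] tower_eq_cylinder[OF assms(1,3)] by metis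
  then show ?thesis
    using bv_cylinder_measure_eq[of n x y] by (simp add: measure_def)
qed

text \<open>A section takes one floor from each tower. Floors of one tower have equal measure, so
  \<open>k\<close> times the measure of the section is the total measure of the floors
  \<open>0, ..., k - 1\<close> of all towers, which are disjoint.\<close>

lemma section_measure_le:
  assumes len: "\<And>b. b \<in> A n \<Longrightarrow> k \<le> length (wd 0 n b)" and f: "\<And>b. b \<in> A n \<Longrightarrow> f b < length (wd 0 n b)"
  shows "real k * measure \<mu> (\<Union>b\<in>A n. tower n b (f b)) \<le> 1"
proof -
  interpret prob_space \<mu> by (rule bv_prob_space)
  have "measure \<mu> (\<Union>b\<in>A n. tower n b (f b)) = (\<Sum>b\<in>A n. measure \<mu> (tower n b (f b)))"
    using finite_alphabet tower_sets f
    by (intro finite_measure_finite_Union) (auto simp: disjoint_family_on_def tower_def)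
  then have "real k * measure \<mu> (\<Union>b\<in>A n. tower n b (f b)) =
      (\<Sum>b\<in>A n. \<Sum>q<k. measure \<mu> (tower n b (f b)))"
    by (simp add: sum_distrib_left)
  also have "\<dots> = (\<Sum>b\<in>A n. \<Sum>q<k. measure \<mu> (tower n b q))"
    using f len by (intro sum.cong refl tower_measure_eq) (auto intro: less_le_trans)
  also have "\<dots> = (\<Sum>(b, q)\<in>A n \<times> {..<k}. measure \<mu> (tower n b q))"
    using finite_alphabet by (simp add: sum.cartesian_product)
  also have "\<dots> = measure \<mu> (\<Union>(b, q)\<in>A n \<times> {..<k}. tower n b q)"
  proof (subst finite_measure_finite_Union)
    show "(\<lambda>(b, q). tower n b q) ` (A n \<times> {..<k}) \<subseteq> events"
      using len by (auto intro!: tower_sets intro: less_le_trans)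
  qed (use finite_alphabet in \<open>auto simp: disjoint_family_on_def tower_def case_prod_unfold\<close>)
  also have "\<dots> \<le> 1"
    by (rule prob_le_1)
  finally show ?thesis .
qed

text \<open>The set lies in the level \<open>n\<close> section for every large \<open>n\<close>, and
  section measures tend to 0 as the towers grow. A measurable null superset puts the set among the
  null sets of the completion.\<close>

lemma persistent_section_null:
  assumes "everywhere_growing A \<sigma>"
    and f: "\<forall>\<^sub>F n in sequentially. \<forall>b\<in>A n. f n b < length (wd 0 n b)"
  shows "\<exists>Z\<in>null_sets \<mu>. {x \<in> bv_paths A \<sigma>. \<forall>n\<ge>N. pos x 0 n = f n (fst (x n))} \<subseteq> Z"
proof -
  interpret prob_space \<mu> by (rule bv_prob_space)
  obtain M where M: "\<And>n b. n \<ge> M \<Longrightarrow> b \<in> A n \<Longrightarrow> f n b < length (wd 0 n b)"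
    using f by (auto simp: eventually_sequentially)
  define S where "S n = (\<Union>b\<in>A n. tower n b (f n b))" for n
  define Z where "Z = (\<Inter>n\<in>{max M N..}. S n)"
  have S: "S n \<in> sets \<mu>" if "n \<ge> M" for n
    unfolding S_def using that M finite_alphabet tower_sets by (intro sets.finite_UN) auto
  then have Z: "Z \<in> sets \<mu>"
    unfolding Z_def by (intro sets.countable_INT') auto
  have "measure \<mu> Z = 0"
  proof (rule ccontr)
    assume "measure \<mu> Z \<noteq> 0"
    then obtain k :: nat where k: "1 < real k * measure \<mu> Z"
      using reals_Archimedean3[of "measure \<mu> Z"] by (auto simp: zero_less_measure_iff)
    obtain n0 where n0: "\<And>n b. n \<ge> n0 \<Longrightarrow> b \<in> A n \<Longrightarrow> k \<le> length (wd 0 n b)"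
      using morph_growing[OF assms(1), of k] by (auto simp: eventually_sequentially)
    define n where "n = max n0 (max M N)"
    have "measure \<mu> Z \<le> measure \<mu> (S n)"
      using S by (intro finite_measure_mono) (auto simp: Z_def n_def)
    moreover have "real k * measure \<mu> (S n) \<le> 1"
      unfolding S_def by (rule section_measure_le) (use n0 M in \<open>auto simp: n_def\<close>)
    ultimately show False
      using k by (meson linorder_not_le mult_left_mono of_nat_0_le_iff order_trans)
  qed
  moreover have "{x \<in> bv_paths A \<sigma>. \<forall>n\<ge>N. pos x 0 n = f n (fst (x n))} \<subseteq> Z"
    using seg_letter[OF _ order_refl] by (auto simp: Z_def S_def tower_def bv_paths_iff_seg)
  ultimately show ?thesis
    using Z by (intro bexI[of _ Z]) (auto simp: emeasure_eq_measure)
qed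

text \<open>An eventually minimal path has an eventually constant number of letters to the left of
  the origin, an eventually maximal one to the right. Both give persistent sections, with countably
  many constants and starting levels.\<close>

lemma not_good_null:
  assumes "everywhere_growing A \<sigma>"
  shows "bv_paths A \<sigma> - good \<in> null_sets (completion \<mu>)"
proof -
  define P where "P N j = {x \<in> bv_paths A \<sigma>. \<forall>n\<ge>N. pos x 0 n = j}" for N j
  define R where "R N j = {x \<in> bv_paths A \<sigma>. \<forall>n\<ge>N. pos x 0 n = length (wd 0 n (fst (x n))) - Suc j}" for N j
  have "P N j \<in> null_sets (completion \<mu>)" for N j
  proof -
    have "\<forall>\<^sub>F n in sequentially. \<forall>b\<in>A n. j < length (wd 0 n b)"
      using morph_growing[OF assms, of "Suc j"] by (simp add: Suc_le_eq)
    from persistent_section_null[OF assms this, of N] show ?thesis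
      unfolding P_def by (meson null_sets_completionI null_sets_completion_subset)
  qed
  moreover have "R N j \<in> null_sets (completion \<mu>)" for N j
  proof -
    have "\<forall>\<^sub>F n in sequentially. \<forall>b\<in>A n. length (wd 0 n b) - Suc j < length (wd 0 n b)"
      using morph_growing[OF assms, of "Suc j"] by eventually_elim fastforce
    from persistent_section_null[OF assms this, of N] show ?thesis
      unfolding R_def by (meson null_sets_completionI null_sets_completion_subset)
  qed
  ultimately have "(\<Union>N j. P N j \<union> R N j) \<in> null_sets (completion \<mu>)"
    by (intro null_sets_UN null_sets.Un)
  moreover have "bv_paths A \<sigma> - good \<subseteq> (\<Union>N j. P N j \<union> R N j)"
  proof
    fix x assume x: "x \<in> bv_paths A \<sigma> - good"
    then consider N where "\<forall>i\<ge>N. pre x i = []" | N where "\<forall>i\<ge>N. post x i = []"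
      unfolding good_def by blast
    then show "x \<in> (\<Union>N j. P N j \<union> R N j)"
    proof cases
      case 1
      have "pos x 0 n = pos x 0 N" if "n \<ge> N" for n
        using that 1 by (induction n rule: dec_induct) (auto simp: pos_Suc)
      then have "x \<in> P N (pos x 0 N)"
        using x unfolding P_def by blast
      then show ?thesis by blast
    next
      case 2
      have r: "rpos x 0 n = rpos x 0 N" if "n \<ge> N" for n
        using that 2 by (induction n rule: dec_induct) (auto simp: rpos_Suc)
      have "pos x 0 n = length (wd 0 n (fst (x n))) - Suc (rpos x 0 N)" if "n \<ge> N" for n
        using length_wd[of 0 n x] r[OF that] x by (simp add: bv_paths_iff_seg)
      then have "x \<in> R N (rpos x 0 N)"
        using x unfolding R_def by blast
      then show ?thesis by blast
    qed
  qed
  ultimately show ?thesis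
    using null_sets_completion_subset by blast
qed

end

subsection \<open>Continuity\<close>

text \<open>The coordinate at \<open>t\<close> is read in a window of finite level, so it is
  constant on a cylinder around each good path.\<close>

lemma continuous_path_word:
  "continuous_map (subtopology (bv_topology A \<sigma>) good)
     (subtopology (sadic_topology A \<sigma>) (path_word 0 ` good)) (path_word 0)"
proof -
  let ?X = "subtopology (bv_topology A \<sigma>) good"
  have top: "topspace ?X = good"
    using good_path by (auto simp: topspace_bv_topology)
  have "continuous_map ?X (discrete_topology (A 0)) (\<lambda>x. path_word 0 x t)" for t
    unfolding continuous_map_def top
  proof (intro conjI allI impI)
    show "(\<lambda>x. path_word 0 x t) \<in> good \<rightarrow> topspace (discrete_topology (A 0))"
      using path_word_in_shift[of _ 0] by (auto simp: sadic_shift_def)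
    fix U
    show "openin ?X {x \<in> good. path_word 0 x t \<in> U}"
      unfolding openin_subopen[of ?X "{x \<in> good. path_word 0 x t \<in> U}"]
    proof
      fix x assume x: "x \<in> {x \<in> good. path_word 0 x t \<in> U}"
      then obtain n where n: "- int (pos x 0 n) \<le> t" "t \<le> int (rpos x 0 n)"
        using good_window[of x 0 0 t t] by blast
      let ?C = "bv_cylinder A \<sigma> (segment_list n x)"
      have eq: "path_word 0 z t = path_word 0 x t" if "z \<in> ?C" for z
      proof -
        have z: "z \<in> bv_paths A \<sigma>" "\<And>i. i \<le> n \<Longrightarrow> z i = x i"
          using that by (auto simp: cylinder_segment simp del: upt_Suc)
        then show ?thesis
          using path_word_eq[OF z(1), of 0 n t] path_word_eq[of x 0 n t] n x good_path
            pos_cong[of n z x 0] rpos_cong[of n z x 0] by simp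
      qed
      have "x \<in> ?C"
        using x good_path by (auto simp: cylinder_segment simp del: upt_Suc)
      moreover have "openin ?X (?C \<inter> good)"
        using openin_cylinder[OF good_seg] x by (auto simp: openin_subtopology)
      ultimately show "\<exists>T. openin ?X T \<and> x \<in> T \<and> T \<subseteq> {x \<in> good. path_word 0 x t \<in> U}"
        using x by (intro exI[of _ "?C \<inter> good"]) (auto dest: eq simp del: upt_Suc)
    qed
  qed
  then have "continuous_map ?X (product_topology (\<lambda>_. discrete_topology (A 0)) UNIV) (path_word 0)"
    by (simp add: continuous_map_componentwise_UNIV)
  then show ?thesis
    unfolding sadic_topology_def subtopology_subtopology continuous_map_in_subtopology top
    using path_word_in_shift by blast
qed

subsection \<open>Counting along orbits\<close>

text \<open>Equal offsets at different positions force different level \<open>n\<close> blocks; the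
  distance is then at least the length of the earlier block.\<close>

lemma pos_gap:
  assumes x: "seg N x" and y: "seg N y" and eq: "fst (x N) = fst (y N)" and n: "n \<le> N"
    and len: "\<And>b. b \<in> A n \<Longrightarrow> g \<le> length (wd 0 n b)"
    and p: "pos x 0 n = pos y 0 n" and less: "pos x 0 N < pos y 0 N"
  shows "pos x 0 N + g \<le> pos y 0 N"
proof -
  define w where "w = wd n N (fst (x N))"
  define B where "B k = length (morph_comp \<sigma> 0 n (take k w))" for k
  have px: "pos x 0 N = B (pos x n N) + pos x 0 n" and py: "pos y 0 N = B (pos y n N) + pos y 0 n"
    using pos_split[of 0 n N] x y n eq by (auto simp: w_def B_def)
  have r: "pos x n N < length w" "pos y n N < length w"
    using length_wd[OF n x] length_wd[OF n y] eq by (auto simp: w_def)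
  have "pos x n N < pos y n N"
    using less p length_morph_comp_take_mono[of "pos y n N" "pos x n N" \<sigma> 0 n w]
    unfolding px py B_def by linarith
  then have "B (pos x n N) + length (wd 0 n (w ! pos x n N)) \<le> B (pos y n N)"
    using r unfolding B_def by (intro length_morph_comp_take_less) auto
  moreover have "g \<le> length (wd 0 n (w ! pos x n N))"
    using len seg_letter[OF x n] nth_wd_pos[OF n x] by (simp add: w_def)
  ultimately show ?thesis
    using px py p by linarith
qed

text \<open>As for \<open>pos_gap\<close>, but with offsets from the right ends of the blocks; here
  the later block supplies the length.\<close>

lemma rpos_gap:
  assumes x: "seg N x" and y: "seg N y" and eq: "fst (x N) = fst (y N)" and n: "n \<le> N"
    and len: "\<And>b. b \<in> A n \<Longrightarrow> g \<le> length (wd 0 n b)"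
    and p: "rpos x 0 n = rpos y 0 n" and less: "pos x 0 N < pos y 0 N"
  shows "pos x 0 N + g \<le> pos y 0 N"
proof -
  define w where "w = wd n N (fst (x N))"
  define B where "B k = length (morph_comp \<sigma> 0 n (take k w))" for k
  have r: "pos x n N < length w" "pos y n N < length w"
    using length_wd[OF n x] length_wd[OF n y] eq by (auto simp: w_def)
  have nx: "w ! pos x n N = fst (x n)" and ny: "w ! pos y n N = fst (y n)"
    using nth_wd_pos[OF n x] nth_wd_pos[OF n y] eq by (auto simp: w_def)
  have BS: "B (Suc k) = B k + length (wd 0 n (w ! k))" if "k < length w" for k
    using that by (simp add: B_def take_Suc_conv_app_nth)
  \<comment> \<open>The position plus the letters to its right in the block plus 1 is the right end
    of the block, hence the next cut.\<close>
  have px: "pos x 0 N + rpos x 0 n + 1 = B (Suc (pos x n N))"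
    using pos_split[of 0 n N x] x n length_wd[of 0 n x] seg_mono[OF x n] BS[OF r(1)] nx
    by (simp add: w_def B_def)
  have py: "pos y 0 N + rpos y 0 n + 1 = B (Suc (pos y n N))"
    using pos_split[of 0 n N y] y n length_wd[of 0 n y] seg_mono[OF y n] BS[OF r(2)] ny eq
    by (simp add: w_def B_def)
  have "pos x n N < pos y n N"
    using less p px py length_morph_comp_take_mono[of "Suc (pos y n N)" "Suc (pos x n N)" \<sigma> 0 n w]
    unfolding B_def by linarith
  then have "B (Suc (pos x n N)) \<le> B (pos y n N)"
    unfolding B_def by (intro length_morph_comp_take_mono) auto
  moreover have "g \<le> length (wd 0 n (fst (y n)))"
    using len seg_letter[OF y n] by simp
  ultimately show ?thesis
    using px py p BS[OF r(2)] ny by simp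
qed

lemma covers_antimono:
  assumes "seg N x" "n \<le> N" "covers x N y"
  shows "covers x n y"
  unfolding covers_def
proof (intro allI impI)
  fix t assume t: "t < length (wd 0 n (fst (x n)))"
  have le: "pos x 0 n \<le> pos x 0 N"
    using assms(2) by (rule pos_mono)
  have "pos x 0 N - pos x 0 n + t < length (wd 0 N (fst (x N)))"
    using t wd_nested[OF _ assms(2,1), of 0] by auto
  then have "y (int (pos x 0 N - pos x 0 n + t) - int (pos x 0 N)) =
      wd 0 N (fst (x N)) ! (pos x 0 N - pos x 0 n + t)"
    using assms(3) unfolding covers_def by blast
  then show "y (int t - int (pos x 0 n)) = wd 0 n (fst (x n)) ! t"
    using nth_wd_nested[OF _ assms(2,1) t] le by (simp add: algebra_simps of_nat_diff)
qed

lemma word_lengths_bounded: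
  obtains W where "\<And>n b. n \<le> N \<Longrightarrow> b \<in> A n \<Longrightarrow> length (wd 0 n b) \<le> W"
proof -
  have "finite ((\<lambda>(n, b). length (wd 0 n b)) ` (SIGMA n:{..N}. A n))"
    using finite_alphabet by auto
  then obtain W where "\<forall>k\<in>(\<lambda>(n, b). length (wd 0 n b)) ` (SIGMA n:{..N}. A n). k \<le> W"
    unfolding finite_nat_set_iff_bounded_le by blast
  then show ?thesis
    by (intro that[of W]) force
qed

text \<open>A long enough window of \<open>y\<close> occurs in one high-level word, and reading off the positions of
  that word gives mutually consistent desubstitutions of all the shifts of \<open>y\<close>.\<close>

lemma orbit_segments:
  assumes y: "y \<in> sadic_shift A \<sigma> 0"
  obtains M p a c where "N \<le> M"
    "\<And>m. m < L \<Longrightarrow> seg M (p m) \<and> fst (p m M) = a \<and> pos (p m) 0 M = c + m \<and>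
       covers (p m) N (shift_pow (int m) y)"
proof -
  obtain W where W: "\<And>n b. n \<le> N \<Longrightarrow> b \<in> A n \<Longrightarrow> length (wd 0 n b) \<le> W"
    using word_lengths_bounded[of N] by metis
  \<comment> \<open>The margin \<open>W\<close> on both sides keeps the level \<open>N\<close>
    windows around the coordinates \<open>0, ..., L - 1\<close> inside \<open>v\<close>. The extra 1
    makes \<open>v\<close> longer than \<open>W\<close> even for \<open>L = W = 0\<close>, which
    forces the level \<open>M\<close> above \<open>N\<close>.\<close>
  define v where "v = map (\<lambda>j. y (- int W + int j)) [0..<L + 2 * W + 1]"
  have lenv: "length v = L + 2 * W + 1"
    by (simp add: v_def)
  have "v \<in> language A \<sigma> 0"
    using y unfolding sadic_shift_def v_def by blast
  then obtain M a where a: "a \<in> A M" and "sublist v (wd 0 M a)"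
    unfolding language_def by blast
  then obtain u u' where u: "wd 0 M a = u @ v @ u'"
    unfolding sublist_def by blast
  have "N \<le> M"
    using W[of M a] a lenv u by (cases "M \<le> N") auto
  have "\<exists>x. seg M x \<and> fst (x M) = a \<and> pos x 0 M = (length u + W) + m" if "m < L" for m
    using a u lenv that by (intro seg_exists) auto
  then obtain p where p: "\<And>m. m < L \<Longrightarrow> seg M (p m) \<and> fst (p m M) = a \<and> pos (p m) 0 M = (length u + W) + m"
    by metis
  have "covers (p m) N (shift_pow (int m) y)" if m: "m < L" for m
    unfolding covers_def
  proof (intro allI impI)
    fix t assume t: "t < length (wd 0 N (fst (p m N)))"
    have s: "seg M (p m)" "seg N (p m)"
      using p[OF m] seg_mono[OF _ \<open>N \<le> M\<close>] by auto
    have "length (wd 0 N (fst (p m N))) \<le> W"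
      using W seg_letter[OF s(2)] by simp
    then have b: "pos (p m) 0 N < W" "t < W"
      using length_wd[OF _ s(2), of 0] t by auto
    define k where "k = W + m + t - pos (p m) 0 N"
    have k: "k < length v" "int k = int W + int m + int t - int (pos (p m) 0 N)"
      using b m lenv by (auto simp: k_def)
    have "wd 0 N (fst (p m N)) ! t = wd 0 M a ! (length u + W + m - pos (p m) 0 N + t)"
      using nth_wd_nested[OF _ \<open>N \<le> M\<close> s(1) t] p[OF m] by simp
    also have "length u + W + m - pos (p m) 0 N + t = length u + k"
      using b by (simp add: k_def)
    also have "wd 0 M a ! (length u + k) = v ! k"
      using k(1) by (simp add: u nth_append)
    also have "\<dots> = y (- int W + int k)"
      using k(1) lenv unfolding v_def by (simp del: upt_Suc)
    also have "- int W + int k = int t - int (pos (p m) 0 N) + int m"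
      using k(2) by simp
    finally show "shift_pow (int m) y (int t - int (pos (p m) 0 N)) = wd 0 N (fst (p m N)) ! t"
      by (simp add: shift_pow_def)
  qed
  then show ?thesis
    using \<open>N \<le> M\<close> p by (intro that[of M p a "length u + W"]) auto
qed

text \<open>Testing only levels \<open>h i \<le> N\<close> makes this a condition on finitely many
  edges, stable under lowering \<open>N\<close>. If it holds for every \<open>N\<close>, the windows
  grow on both sides and a path is good.\<close>

definition admissible :: "(nat \<Rightarrow> nat) \<Rightarrow> nat \<Rightarrow> (nat \<Rightarrow> 'a edge) \<Rightarrow> bool" where
  "admissible h N x \<longleftrightarrow> (\<forall>i. h i \<le> N \<longrightarrow> i \<le> pos x 0 (h i) \<and> i \<le> rpos x 0 (h i))"

definition reach :: "(nat \<Rightarrow> nat) \<Rightarrow> nat \<Rightarrow> (int \<Rightarrow> 'a) set" where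
  "reach h N = {y. \<exists>x. seg N x \<and> covers x N y \<and> admissible h N x}"

lemma reach_antimono:
  assumes "M \<le> N"
  shows "reach h N \<subseteq> reach h M"
proof -
  have "admissible h M x" if "admissible h N x" for x
    using that assms by (auto simp: admissible_def)
  then show ?thesis
    using seg_mono[OF _ assms] covers_antimono[OF _ assms] unfolding reach_def by blast
qed

text \<open>Segments for different \<open>N\<close> need not extend each other; as each level has
  finitely many edges, \<open>koenig\<close> yields one path for all levels. Admissibility at every
  \<open>h k\<close> makes it good.\<close>

lemma reach_all_imp_path_word:
  assumes "\<And>N. y \<in> reach h N"
  shows "y \<in> path_word 0 ` good"
proof -
  have "\<exists>x. \<forall>N. seg N x \<and> covers x N y \<and> admissible h N x"
  proof (rule koenig[where F = "bv_edges A \<sigma>"])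
    show "\<exists>x. seg N x \<and> covers x N y \<and> admissible h N x" for N
      using assms[of N] by (simp add: reach_def)
    show "seg M x \<and> covers x M y \<and> admissible h M x"
      if "M \<le> N" "seg N x \<and> covers x N y \<and> admissible h N x" for M N x
      using that seg_mono covers_antimono by (auto simp: admissible_def)
    show "seg N z \<and> covers z N y \<and> admissible h N z"
      if eq: "\<And>i. i \<le> N \<Longrightarrow> x i = z i" and x: "seg N x \<and> covers x N y \<and> admissible h N x" for N x z
    proof -
      have "pos z 0 n = pos x 0 n" "rpos z 0 n = rpos x 0 n" if "n \<le> N" for n
        using eq that by (auto intro!: pos_cong rpos_cong)
      then show ?thesis
        using x eq[of N] seg_cong[of N x z] eq by (simp add: covers_def admissible_def)
    qed
    have "bv_edges A \<sigma> (Suc n) = (SIGMA a:A (Suc n). {..<length (\<sigma> n a)})" for n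
      by auto
    then show "finite (bv_edges A \<sigma> i)" for i
      using finite_alphabet by (cases i) (auto simp: Collect_case_prod_Sigma intro: finite_subset[of _ "A 0 \<times> {0}"])
  qed (simp add: seg_def)
  then obtain x where x: "\<And>N. seg N x" "\<And>N. covers x N y" "\<And>N. admissible h N x"
    by blast
  have "k \<le> pos x 0 (h k)" "k \<le> rpos x 0 (h k)" for k
    using x(3)[of "h k"] by (auto simp: admissible_def)
  then have "x \<in> good"
    using x(1) by (intro goodI_unbounded) (auto simp: bv_paths_iff_seg)
  then show ?thesis
    using path_word_unique[of x y] x(2) by blast
qed

text \<open>The segment of an unreached shift has, at some tested level \<open>h i\<close>, fewer
  than \<open>i\<close> letters on one side of the origin. For a fixed side and distance such shifts
  are \<open>g i\<close>-separated by the gap lemmas, and there are \<open>2 * i\<close> choices of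
  side and distance.\<close>

lemma card_unreached_le:
  assumes y: "y \<in> sadic_shift A \<sigma> 0"
    and h: "\<And>i. i \<le> h i" and g: "\<And>i. g i > 0" "\<And>i b. b \<in> A (h i) \<Longrightarrow> g i \<le> length (wd 0 (h i) b)"
  shows "real (card {m\<in>{..<L}. shift_pow (int m) y \<notin> reach h N}) \<le>
    (\<Sum>i\<le>N. 2 * real i * (real L / real (g i) + 1))"
proof -
  obtain M p a c where M: "N \<le> M" and p: "\<And>m. m < L \<Longrightarrow> seg M (p m) \<and> fst (p m M) = a \<and>
      pos (p m) 0 M = c + m \<and> covers (p m) N (shift_pow (int m) y)"
    using orbit_segments[OF y, of N L] by blast
  define I where "I = {i. h i \<le> N}"
  have I: "I \<subseteq> {..N}" "finite I"
    using h by (auto simp: I_def intro: order_trans finite_subset[of _ "{..N}"])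
  define S1 where "S1 i j = {m\<in>{..<L}. pos (p m) 0 (h i) = j}" for i j
  define S2 where "S2 i j = {m\<in>{..<L}. rpos (p m) 0 (h i) = j}" for i j
  have sub: "{m\<in>{..<L}. shift_pow (int m) y \<notin> reach h N} \<subseteq> (\<Union>i\<in>I. \<Union>j<i. S1 i j \<union> S2 i j)"
  proof
    fix m assume m: "m \<in> {m\<in>{..<L}. shift_pow (int m) y \<notin> reach h N}"
    then have "seg N (p m)" "covers (p m) N (shift_pow (int m) y)"
      using p[of m] seg_mono[OF _ M] by auto
    then have "\<not> admissible h N (p m)"
      using m by (auto simp: reach_def)
    then obtain i where "h i \<le> N" "pos (p m) 0 (h i) < i \<or> rpos (p m) 0 (h i) < i"
      by (auto simp: admissible_def not_le)
    then show "m \<in> (\<Union>i\<in>I. \<Union>j<i. S1 i j \<union> S2 i j)"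
      using m by (auto simp: I_def S1_def S2_def)
  qed
  have c1: "real (card (S1 i j)) \<le> real L / real (g i) + 1" if "i \<in> I" for i j
  proof (rule card_separated_le)
    show "m + g i \<le> n" if "m \<in> S1 i j" "n \<in> S1 i j" "m < n" for m n
      using pos_gap[of M "p m" "p n" "h i" "g i"] p[of m] p[of n] that g(2)[of _ i] M \<open>i \<in> I\<close>
      by (auto simp: S1_def I_def)
  qed (use g in \<open>auto simp: S1_def\<close>)
  have c2: "real (card (S2 i j)) \<le> real L / real (g i) + 1" if "i \<in> I" for i j
  proof (rule card_separated_le)
    show "m + g i \<le> n" if "m \<in> S2 i j" "n \<in> S2 i j" "m < n" for m n
      using rpos_gap[of M "p m" "p n" "h i" "g i"] p[of m] p[of n] that g(2)[of _ i] M \<open>i \<in> I\<close>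
      by (auto simp: S2_def I_def)
  qed (use g in \<open>auto simp: S2_def\<close>)
  have fin: "finite (S1 i j)" "finite (S2 i j)" for i j
    by (auto simp: S1_def S2_def)
  have "card {m\<in>{..<L}. shift_pow (int m) y \<notin> reach h N} \<le> card (\<Union>i\<in>I. \<Union>j<i. S1 i j \<union> S2 i j)"
    using I fin by (intro card_mono[OF _ sub]) auto
  also have "\<dots> \<le> (\<Sum>i\<in>I. card (\<Union>j<i. S1 i j \<union> S2 i j))"
    using I by (intro card_UN_le) auto
  also have "\<dots> \<le> (\<Sum>i\<in>I. \<Sum>j<i. card (S1 i j \<union> S2 i j))"
    by (intro sum_mono card_UN_le) auto
  also have "\<dots> \<le> (\<Sum>i\<in>I. \<Sum>j<i. card (S1 i j) + card (S2 i j))"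
    by (intro sum_mono card_Un_le)
  finally have "real (card {m\<in>{..<L}. shift_pow (int m) y \<notin> reach h N}) \<le>
      real (\<Sum>i\<in>I. \<Sum>j<i. card (S1 i j) + card (S2 i j))"
    by (rule of_nat_mono)
  also have "\<dots> = (\<Sum>i\<in>I. \<Sum>j<i. real (card (S1 i j)) + real (card (S2 i j)))"
    by simp
  also have "\<dots> \<le> (\<Sum>i\<in>I. \<Sum>j<i. (real L / real (g i) + 1) + (real L / real (g i) + 1))"
    by (intro sum_mono add_mono c1 c2)
  also have "\<dots> = (\<Sum>i\<in>I. 2 * real i * (real L / real (g i) + 1))"
    by (simp add: algebra_simps)
  also have "\<dots> \<le> (\<Sum>i\<le>N. 2 * real i * (real L / real (g i) + 1))"
    using I by (intro sum_mono2) auto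
  finally show ?thesis .
qed

subsection \<open>Almost every point of the shift is the word of a good path\<close>

lemma shift_pow_sadic_shift:
  assumes "y \<in> sadic_shift A \<sigma> n"
  shows "shift_pow k y \<in> sadic_shift A \<sigma> n"
proof -
  have "map (\<lambda>j. shift_pow k y (i + int j)) [0..<l] = map (\<lambda>j. y ((i + k) + int j)) [0..<l]" for i l
    by (simp add: shift_pow_def add.assoc add.commute[of k])
  moreover have "map (\<lambda>j. y ((i + k) + int j)) [0..<l] \<in> language A \<sigma> n" for i l
    using assms unfolding sadic_shift_def by blast
  moreover have "shift_pow k y i \<in> A n" for i
    using assms by (simp add: sadic_shift_def shift_pow_def)
  ultimately show ?thesis
    unfolding sadic_shift_def mem_Collect_eq by metis
qed

lemma openin_sadic_coordinate: "openin (sadic_topology A \<sigma>) {y \<in> sadic_shift A \<sigma> 0. y s = a}"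
proof (cases "a \<in> A 0")
  case True
  have "continuous_map (sadic_topology A \<sigma>) (discrete_topology (A 0)) (\<lambda>y. y s)"
    unfolding sadic_topology_def
    by (intro continuous_map_from_subtopology continuous_map_product_projection) simp
  from openin_continuous_map_preimage[OF this, of "{a}"] True show ?thesis
    by (simp add: topspace_sadic_topology)
next
  case False
  then have "{y \<in> sadic_shift A \<sigma> 0. y s = a} = {}"
    by (auto simp: sadic_shift_def)
  then show ?thesis by (simp only: openin_empty)
qed

text \<open>The segment occurs only in a condition free of \<open>y\<close>. What remains on
  \<open>y\<close> is a finite combination of coordinate conditions, from which
  \<open>unreached_sets\<close> obtains measurability.\<close>

lemma reach_iff:
  "y \<in> reach h N \<longleftrightarrow> (\<exists>b\<in>A N. \<exists>q\<in>{..<length (wd 0 N b)}.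
     (\<exists>x. seg N x \<and> fst (x N) = b \<and> pos x 0 N = q \<and> admissible h N x) \<and>
     (\<forall>t\<in>{..<length (wd 0 N b)}. y (int t - int q) = wd 0 N b ! t))"
proof
  assume "y \<in> reach h N"
  then obtain x where x: "seg N x" "covers x N y" "admissible h N x"
    by (auto simp: reach_def)
  then have "fst (x N) \<in> A N" "pos x 0 N < length (wd 0 N (fst (x N)))"
    using seg_letter[of N x N] length_wd[of 0 N x] by auto
  with x show "\<exists>b\<in>A N. \<exists>q\<in>{..<length (wd 0 N b)}.
     (\<exists>x. seg N x \<and> fst (x N) = b \<and> pos x 0 N = q \<and> admissible h N x) \<and>
     (\<forall>t\<in>{..<length (wd 0 N b)}. y (int t - int q) = wd 0 N b ! t)"
    by (intro bexI[of _ "fst (x N)"] bexI[of _ "pos x 0 N"]) (auto simp: covers_def)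
qed (auto simp: reach_def covers_def)

section \<open>Averaging against an invariant measure on the shift\<close>

context
  fixes \<mu> :: "(int \<Rightarrow> 'a) measure"
  assumes \<mu>: "\<mu> \<in> sys_inv (sadic_system A \<sigma>)"
begin

lemma sadic_prob_space: "prob_space \<mu>"
  and sets_sadic: "sets \<mu> = sets (borel_of (sadic_topology A \<sigma>))"
  and sadic_invariant: "B \<in> sets \<mu> \<Longrightarrow> emeasure \<mu> (left_shift -` B \<inter> space \<mu>) = emeasure \<mu> B"
  using \<mu> by (auto simp: sadic_system_def)

lemma space_sadic: "space \<mu> = sadic_shift A \<sigma> 0"
  using sets_eq_imp_space_eq[OF sets_sadic] by (simp add: space_borel_of topspace_sadic_topology)

definition unreached :: "(nat \<Rightarrow> nat) \<Rightarrow> nat \<Rightarrow> nat \<Rightarrow> (int \<Rightarrow> 'a) set" where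
  "unreached h N m = {y \<in> space \<mu>. shift_pow (int m) y \<notin> reach h N}"

lemma unreached_sets: "unreached h N m \<in> sets \<mu>"
proof -
  have coord: "{y \<in> space \<mu>. y s = a} \<in> sets \<mu>" for s a
    unfolding space_sadic sets_sadic by (rule sets_borel_of_openin) (rule openin_sadic_coordinate)
  show ?thesis
    unfolding unreached_def reach_iff shift_pow_def
    by (intro sets.sets_Collect_neg sets.sets_Collect_finite_Ex sets.sets_Collect_finite_All
        sets.sets_Collect_conj sets.sets_Collect_const coord finite_alphabet) auto
qed

lemma unreached_measure: "measure \<mu> (unreached h N m) = measure \<mu> (unreached h N 0)"
proof (induction m)
  case (Suc m)
  have "unreached h N (Suc m) = left_shift -` unreached h N m \<inter> space \<mu>"
    using shift_pow_sadic_shift[of _ 0 1]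
    by (auto simp: unreached_def space_sadic shift_pow_def algebra_simps)
  then have "emeasure \<mu> (unreached h N (Suc m)) = emeasure \<mu> (unreached h N m)"
    using sadic_invariant[OF unreached_sets] by simp
  with Suc show ?case
    by (simp add: measure_def)
qed simp

text \<open>By invariance, \<open>L\<close> times the measure is the mean number of unreached shifts
  among the first \<open>L\<close>, which is at most \<open>L / K + C\<close> pointwise. As
  \<open>C\<close> does not depend on \<open>L\<close>, it disappears for large
  \<open>L\<close>.\<close>

lemma unreached_measure_le:
  assumes K: "K > 0" and h: "\<And>i. i \<le> h i"
    and len: "\<And>i b. b \<in> A (h i) \<Longrightarrow> (2 * i + 1) * 2 ^ Suc i * K \<le> length (wd 0 (h i) b)"
  shows "measure \<mu> (unreached h N 0) \<le> 1 / real K"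
proof -
  interpret prob_space \<mu> by (rule sadic_prob_space)
  \<comment> \<open>The factor \<open>2 * i + 1\<close> absorbs the \<open>2 * i\<close> choices and
    is positive at \<open>i = 0\<close>; \<open>2 ^ Suc i\<close> makes the densities sum to at most
    \<open>1 / K\<close>.\<close>
  define g where "g i = (2 * i + 1) * 2 ^ Suc i * K" for i
  define C where "C = (\<Sum>i\<le>N. 2 * real i)"
  have term_le: "2 * real i * (real L / real (g i) + 1) \<le> real L / real K * (1 / 2) ^ Suc i + 2 * real i" for i L
  proof -
    define c where "c = real K * 2 ^ Suc i"
    have "real (g i) = (2 * real i + 1) * c"
      by (simp add: g_def c_def algebra_simps)
    moreover have "c > 0"
      using K by (simp add: c_def)
    ultimately have "2 * real i / real (g i) \<le> 1 / (real K * 2 ^ Suc i)"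
      unfolding c_def[symmetric] by (simp add: divide_simps)
    then have "real L * (2 * real i / real (g i)) \<le> real L * (1 / (real K * 2 ^ Suc i))"
      by (intro mult_left_mono) auto
    then show ?thesis
      by (simp add: field_simps power_one_over)
  qed
  have bound: "(\<Sum>i\<le>N. 2 * real i * (real L / real (g i) + 1)) \<le> real L / real K + C" for L
  proof -
    have "(\<Sum>i\<le>N. (1 / 2 :: real) ^ Suc i) \<le> 1"
    proof -
      have "(\<Sum>i\<le>N. (1 / 2 :: real) ^ Suc i) = 1 - (1 / 2) ^ Suc N"
        by (induction N) auto
      then show ?thesis by simp
    qed
    then have "real L / real K * (\<Sum>i\<le>N. (1 / 2) ^ Suc i) \<le> real L / real K * 1"
      by (intro mult_left_mono) auto
    moreover have "(\<Sum>i\<le>N. 2 * real i * (real L / real (g i) + 1)) \<le>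
        (\<Sum>i\<le>N. real L / real K * (1 / 2) ^ Suc i + 2 * real i)"
      by (intro sum_mono term_le)
    ultimately show ?thesis
      unfolding sum.distrib sum_distrib_left[symmetric] C_def by linarith
  qed
  have avg: "real L * measure \<mu> (unreached h N 0) \<le> real L / real K + C" for L
  proof -
    have "real L * measure \<mu> (unreached h N 0) = (\<Sum>m<L. measure \<mu> (unreached h N 0))"
      by simp
    also have "\<dots> = (\<Sum>m<L. measure \<mu> (unreached h N m))"
      by (intro sum.cong refl unreached_measure[symmetric])
    also have "\<dots> = (\<Sum>m<L. \<integral>y. indicator (unreached h N m) y \<partial>\<mu>)"
      using unreached_sets[THEN sets.sets_into_space] by (simp add: Int_absorb2)
    also have "\<dots> = (\<integral>y. (\<Sum>m<L. indicator (unreached h N m) y) \<partial>\<mu>)"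
      using unreached_sets by (intro Bochner_Integration.integral_sum[symmetric] integrable_real_indicator)
        (auto simp: less_top[symmetric])
    also have "\<dots> \<le> real L / real K + C"
    proof (rule integral_le_const)
      show "integrable \<mu> (\<lambda>y. \<Sum>m<L. indicator (unreached h N m) y :: real)"
        using unreached_sets by (intro Bochner_Integration.integrable_sum integrable_real_indicator)
          (auto simp: less_top[symmetric])
      show "AE y in \<mu>. (\<Sum>m<L. indicator (unreached h N m) y :: real) \<le> real L / real K + C"
      proof (rule AE_I2)
        fix y assume y: "y \<in> space \<mu>"
        have "(\<Sum>m<L. indicator (unreached h N m) y :: real) =
            real (card {m\<in>{..<L}. shift_pow (int m) y \<notin> reach h N})"
          using y by (simp add: unreached_def indicator_def sum.If_cases Int_def)
        also have "\<dots> \<le> (\<Sum>i\<le>N. 2 * real i * (real L / real (g i) + 1))"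
          using y h len K by (intro card_unreached_le) (auto simp: space_sadic g_def)
        also have "\<dots> \<le> real L / real K + C"
          by (rule bound)
        finally show "(\<Sum>m<L. indicator (unreached h N m) y :: real) \<le> real L / real K + C" .
      qed
    qed
    finally show ?thesis .
  qed
  show ?thesis
  proof (rule ccontr)
    assume "\<not> ?thesis"
    then have "measure \<mu> (unreached h N 0) - 1 / real K > 0" by simp
    then obtain L :: nat where "C < real L * (measure \<mu> (unreached h N 0) - 1 / real K)"
      using reals_Archimedean3 by blast
    with avg[of L] show False
      by (simp add: algebra_simps)
  qed
qed

text \<open>Each \<open>K\<close> gets its own levels \<open>h K\<close>, with failure probability
  at most \<open>1 / Suc K\<close>. A point outside the image is unreached at some \<open>N\<close>
  for every \<open>K\<close>, so it lies in every \<open>Z K\<close>.\<close>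

lemma not_path_word_null:
  assumes "everywhere_growing A \<sigma>"
  shows "sadic_shift A \<sigma> 0 - path_word 0 ` good \<in> null_sets (completion \<mu>)"
proof -
  interpret prob_space \<mu> by (rule sadic_prob_space)
  have "\<exists>n\<ge>i. \<forall>b\<in>A n. (2 * i + 1) * 2 ^ Suc i * Suc K \<le> length (wd 0 n b)" for i K
    using eventually_conj[OF eventually_ge_at_top[of i] morph_growing[OF assms]]
    by (rule eventually_happens'[OF sequentially_bot])
  then have "\<exists>h. \<forall>K i. h K i \<ge> i \<and> (\<forall>b\<in>A (h K i). (2 * i + 1) * 2 ^ Suc i * Suc K \<le> length (wd 0 (h K i) b))"
    by (intro choice allI)
  then obtain h where h: "\<And>K i. i \<le> h K i"
    "\<And>K i b. b \<in> A (h K i) \<Longrightarrow> (2 * i + 1) * 2 ^ Suc i * Suc K \<le> length (wd 0 (h K i) b)"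
    by blast
  define Z where "Z K = (\<Union>N. unreached (h K) N 0)" for K
  have Z: "Z K \<in> sets \<mu>" for K
    unfolding Z_def using unreached_sets by auto
  have Z_le: "measure \<mu> (Z K) \<le> 1 / real (Suc K)" for K
  proof -
    have "incseq (\<lambda>N. unreached (h K) N 0)"
      using reach_antimono by (fastforce simp: incseq_def unreached_def)
    then have "(\<lambda>N. measure \<mu> (unreached (h K) N 0)) \<longlonglongrightarrow> measure \<mu> (Z K)"
      unfolding Z_def using unreached_sets by (intro finite_Lim_measure_incseq) auto
    then show ?thesis
      using unreached_measure_le[of "Suc K" "h K"] h by (intro LIMSEQ_le_const2) auto
  qed
  have "measure \<mu> (\<Inter>K. Z K) = 0"
  proof -
    have "measure \<mu> (\<Inter>K. Z K) \<le> 1 / real (Suc K)" for K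
      using finite_measure_mono[OF _ Z, of "\<Inter>K. Z K" K] Z_le[of K] by force
    then have "measure \<mu> (\<Inter>K. Z K) \<le> 0"
      using LIMSEQ_inverse_real_of_nat by (intro LIMSEQ_le_const[of _ 0]) (auto simp: inverse_eq_divide)
    then show ?thesis
      using measure_nonneg[of \<mu> "\<Inter>K. Z K"] by linarith
  qed
  then have "(\<Inter>K. Z K) \<in> null_sets \<mu>"
    using Z by (intro null_setsI) (auto simp: emeasure_eq_measure)
  moreover have "sadic_shift A \<sigma> 0 - path_word 0 ` good \<subseteq> (\<Inter>K. Z K)"
    using reach_all_imp_path_word by (force simp: Z_def unreached_def space_sadic shift_pow_def)
  ultimately show ?thesis
    using null_sets_completionI null_sets_completion_subset by blast
qed

end

subsection \<open>The exceptional sets\<close>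

lemma topspace_bv: "topspace (sys_top (bratteli_vershik_system A \<sigma>)) = bv_paths A \<sigma>"
  and topspace_sadic: "topspace (sys_top (sadic_system A \<sigma>)) = sadic_shift A \<sigma> 0"
  by (simp_all add: bratteli_vershik_system_def sadic_system_def topspace_bv_topology
      topspace_sadic_topology)

lemma exceptional_bv:
  assumes "everywhere_growing A \<sigma>"
  shows "exceptional_set (bratteli_vershik_system A \<sigma>) (bv_paths A \<sigma> - good)"
proof -
  have "bv_paths A \<sigma> - (bv_paths A \<sigma> - good) = good"
    using good_path by blast
  moreover have "bv_max_paths A \<sigma> \<union> bv_min_paths A \<sigma> \<subseteq> bv_paths A \<sigma> - good"
    using good_not_extremal by (auto simp: bv_max_paths_def bv_min_paths_def)
  moreover have "sys_map (bratteli_vershik_system A \<sigma>) = vershik_map A \<sigma>"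
    "sys_sing (bratteli_vershik_system A \<sigma>) = bv_max_paths A \<sigma> \<union> bv_min_paths A \<sigma>"
    by (simp_all add: bratteli_vershik_system_def)
  ultimately show ?thesis
    using not_good_null[OF _ assms] bij_vershik_map
    unfolding exceptional_set_def invariant_set_def topspace_bv by auto
qed

lemma exceptional_sadic:
  assumes "everywhere_growing A \<sigma>"
  shows "exceptional_set (sadic_system A \<sigma>) (sadic_shift A \<sigma> 0 - path_word 0 ` good)"
proof -
  have diff: "sadic_shift A \<sigma> 0 - (sadic_shift A \<sigma> 0 - path_word 0 ` good) = path_word 0 ` good"
    using path_word_in_shift by blast
  have "inj_on left_shift (path_word 0 ` good)"
  proof (rule inj_onI, rule ext)
    fix y z :: "int \<Rightarrow> 'a" and i
    assume "left_shift y = left_shift z"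
    from fun_cong[OF this, of "i - 1"] show "y i = z i"
      by (simp add: shift_pow_def)
  qed
  \<comment> \<open>Equivariance transports surjectivity of the Vershik map on \<open>good\<close>
    to the shift on the image.\<close>
  moreover have "left_shift ` path_word 0 ` good = path_word 0 ` vershik_map A \<sigma> ` good"
    by (simp add: image_image path_word_vershik_map)
  ultimately have "bij_betw left_shift (path_word 0 ` good) (path_word 0 ` good)"
    using bij_vershik_map by (simp add: bij_betw_def)
  moreover have "sys_map (sadic_system A \<sigma>) = left_shift" "sys_sing (sadic_system A \<sigma>) = {}"
    by (simp_all add: sadic_system_def)
  ultimately show ?thesis
    using not_path_word_null[OF _ assms] diff
    unfolding exceptional_set_def invariant_set_def topspace_sadic by auto
qed

text \<open>Collects what both conclusions share; only injectivity of \<open>path_word 0\<close>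
  separates the almost-factor map from an almost-conjugacy.\<close>

lemma path_word_almost_factor_map:
  assumes "everywhere_growing A \<sigma>"
  defines "D \<equiv> bv_paths A \<sigma> - good" and "E \<equiv> sadic_shift A \<sigma> 0 - path_word 0 ` good"
    and "S \<equiv> bratteli_vershik_system A \<sigma>" and "R \<equiv> sadic_system A \<sigma>"
  shows "exceptional_set S D" "exceptional_set R E"
    "topspace (sys_top S) - D = good" "topspace (sys_top R) - E = path_word 0 ` good"
    "continuous_map (subtopology (sys_top S) good) (subtopology (sys_top R) (path_word 0 ` good))
       (path_word 0)"
    "\<forall>x\<in>good. path_word 0 (sys_map S x) = sys_map R (path_word 0 x)"
proof -
  show "exceptional_set S D" "exceptional_set R E"
    using exceptional_bv exceptional_sadic assms by auto
  show "topspace (sys_top S) - D = good" "topspace (sys_top R) - E = path_word 0 ` good"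
    using good_path path_word_in_shift by (auto simp: D_def E_def S_def R_def topspace_bv topspace_sadic)
  show "continuous_map (subtopology (sys_top S) good) (subtopology (sys_top R) (path_word 0 ` good))
       (path_word 0)"
    using continuous_path_word by (simp add: S_def R_def bratteli_vershik_system_def sadic_system_def)
  show "\<forall>x\<in>good. path_word 0 (sys_map S x) = sys_map R (path_word 0 x)"
    using path_word_vershik_map by (simp add: S_def R_def bratteli_vershik_system_def sadic_system_def)
qed

end

theorem theorem6p5:
  fixes A :: "nat \<Rightarrow> 'a set" and \<sigma> :: "nat \<Rightarrow> 'a \<Rightarrow> 'a list"
  assumes "morphism_sequence A \<sigma>" and "everywhere_growing A \<sigma>"
  shows "is_almost_factor_of (sadic_system A \<sigma>) (bratteli_vershik_system A \<sigma>) \<and>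
         (recognizable A \<sigma> \<longrightarrow>
            almost_conjugate (sadic_system A \<sigma>) (bratteli_vershik_system A \<sigma>))"
proof -
  interpret morph_seq A \<sigma>
    using assms(1) by unfold_locales
  note factor = path_word_almost_factor_map[OF assms(2)]
  have "almost_factor_map (bratteli_vershik_system A \<sigma>) (sadic_system A \<sigma>) (path_word 0)"
    unfolding almost_factor_map_def using factor
    by (intro exI[of _ "bv_paths A \<sigma> - good"] exI[of _ "sadic_shift A \<sigma> 0 - path_word 0 ` good"]) simp
  moreover have "almost_conjugacy (bratteli_vershik_system A \<sigma>) (sadic_system A \<sigma>) (path_word 0)"
    if "recognizable A \<sigma>"
    unfolding almost_conjugacy_def using factor path_word_inj[OF that]
    by (intro exI[of _ "bv_paths A \<sigma> - good"] exI[of _ "sadic_shift A \<sigma> 0 - path_word 0 ` good"])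
       (simp add: bij_betw_def)
  \<comment> \<open>The map runs from the path space to the shift, so the second alternative of
    \<open>almost_conjugate\<close> applies.\<close>
  ultimately show ?thesis
    unfolding is_almost_factor_of_def almost_conjugate_def by blast
qed

end
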